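(* Let $\rho^0\in L^1(\mathbb{R}^2)$ with $\rho^0\ge0$, and assume $\partial_x\rho^0,\partial_y\rho^0\in L^\infty(\mathbb{R}^2)$. Let $\varepsilon>0$ and let $L>0$ be such that $$\iint_{\mathbb{R}^2\setminus[-L,L]^2}\rho^0(x,y)\,dx\,dy\le\varepsilon.$$ For every integer $N\ge1$ let $\hat\rho^{N,\varepsilon}$ be the piecewise constant density on $[-L,L]^2$ associated with $\rho^0$, $L$, $N$ (defined in the context). Then for every $\varphi\in C_c^\infty(\mathbb{R}^2)$ and every $N\ge 1$, $$\left|\iint_{\mathbb{R}^2}\hat\rho^{N,\varepsilon}(x,y)\varphi(x,y)\,dx\,dy-\iint_{\mathbb{R}^2}\rho^0(x,y)\varphi(x,y)\,dx\,dy\right|\le\varepsilon\|\varphi\|_\infty+\frac{C_\varepsilon(\varphi)}{N^2},$$ where $$C_\varepsilon(\varphi)=16L^4(\|\partial_x\rho^0\|_\infty+\|\partial_y\rho^0\|_\infty)(\|\partial_x\varphi\|_\infty+\|\partial_y\varphi\|_\infty).$$ Moreover, let $\omega^0\in L^\infty(\mathbb{R}^2)$ be such that $\partial_x\omega^0,\partial_y\omega^0\in L^\infty(\mathbb{R}^2)$, and let $\hat\rho^{N,\varepsilon}\hat\omega^{N,\varepsilon}$ be the associated piecewise constant quantity (defined in the context). Then for every $\varphi\in C_c^\infty(\mathbb{R}^2)$ and every $N\ge 1$, $$\left|\iint_{\mathbb{R}^2}(\hat\rho^{N,\varepsilon}\hat\omega^{N,\varepsilon})(x,y)\varphi(x,y)\,dx\,dy-\iint_{\mathbb{R}^2}\rho^0(x,y)\omega^0(x,y)\varphi(x,y)\,dx\,dy\right|\le\varepsilon\|\varphi\|_\infty\|\omega^0\|_\infty+\frac{C_\varepsilon(\varphi)\|\omega^0\|_\infty}{N^2}+\frac{K_\varepsilon(\varphi)}{N},$$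 where $$K_\varepsilon(\varphi)=2L(\|\partial_x\omega^0\|_\infty+\|\partial_y\omega^0\|_\infty)\|\varphi\|_\infty\|\rho^0\|_1.$$
   Context: Notation: given $L>0$, an integer $N\ge1$ and $k\in\{0,\dots,N\}$, $\overline{x}_k^N=\overline{y}_k^N=-L+k\frac{2L}{N}$. For $i,j\in\{0,\dots,N-1\}$, $$a_{i,j}^N=\frac{N^2}{4L^2}\int_{\overline{x}_i^N}^{\overline{x}_{i+1}^N}\int_{\overline{y}_j^N}^{\overline{y}_{j+1}^N}\rho^0(x,y)\,dy\,dx,\qquad W_{i,j}^N=\frac{N^2}{4L^2}\int_{\overline{x}_i^N}^{\overline{x}_{i+1}^N}\int_{\overline{y}_j^N}^{\overline{y}_{j+1}^N}\omega^0(x,y)\,dy\,dx.$$ The piecewise constant density (depending on $\varepsilon$ through $L$) is $$\hat\rho^{N,\varepsilon}(x,y)=\sum_{i=0}^{N-1}\sum_{j=0}^{N-1}a_{i,j}^N\,\mathbf{1}_{[\overline{x}_i^N,\overline{x}_{i+1}^N[}(x)\,\mathbf{1}_{[\overline{y}_j^N,\overline{y}_{j+1}^N[}(y),$$ and the piecewise constant quantity $\hat\rho^{N,\varepsilon}\hat\omega^{N,\varepsilon}$ (a single function) is $$(\hat\rho^{N,\varepsilon}\hat\omega^{N,\varepsilon})(x,y)=\sum_{i=0}^{N-1}\sum_{j=0}^{N-1}a_{i,j}^N W_{i,j}^N\,\mathbf{1}_{[\overline{x}_i^N,\overline{x}_{i+1}^N[}(x)\,\mathbf{1}_{[\overline{y}_j^N,\overline{y}_{j+1}^N[}(y).$$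 $\|\cdot\|_1$ and $\|\cdot\|_\infty$ are the norms of $L^1(\mathbb{R}^2)$ and $L^\infty(\mathbb{R}^2)$. Partial derivatives of $\rho^0,\omega^0$ are weak derivatives. *)

theory Defs
  imports "HOL-Analysis.Analysis" "HOL-Probability.Essential_Supremum"
begin

(* Elements of L^1 and L^infinity are represented by Lebesgue measurable functions on
   real \<times> real.  Weak partial derivatives are relations between such representatives and
   are unique only almost everywhere; partial_x and partial_y are the classical derivatives. *)

definition L1_norm :: "(real \<times> real \<Rightarrow> real) \<Rightarrow> real" where
  "L1_norm f = (LINT p|lebesgue. \<bar>f p\<bar>)"

definition Linf :: "(real \<times> real \<Rightarrow> real) set" where
  "Linf = {f \<in> borel_measurable lebesgue. esssup lebesgue (\<lambda>p. ereal \<bar>f p\<bar>) < \<infinity>}"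

(* The true norm only on Linf; real_of_ereal sends an infinite supremum to 0. *)
definition Linf_norm :: "(real \<times> real \<Rightarrow> real) \<Rightarrow> real" where
  "Linf_norm f = real_of_ereal (esssup lebesgue (\<lambda>p. ereal \<bar>f p\<bar>))"

definition partial_x :: "(real \<times> real \<Rightarrow> real) \<Rightarrow> real \<times> real \<Rightarrow> real" where
  "partial_x f = (\<lambda>(x, y). deriv (\<lambda>t. f (t, y)) x)"

definition partial_y :: "(real \<times> real \<Rightarrow> real) \<Rightarrow> real \<times> real \<Rightarrow> real" where
  "partial_y f = (\<lambda>(x, y). deriv (\<lambda>t. f (x, t)) y)"

(* Class C^k.  Continuity of f itself need not be required in the step, since a function
   whose first partial derivatives exist everywhere and are continuous is continuous. *)
primrec C_k :: "nat \<Rightarrow> (real \<times> real \<Rightarrow> real) \<Rightarrow> bool" where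
  "C_k 0 f \<longleftrightarrow> continuous_on UNIV f"
| "C_k (Suc k) f \<longleftrightarrow>
     (\<forall>x y. (\<lambda>t. f (t, y)) differentiable (at x) \<and> (\<lambda>t. f (x, t)) differentiable (at y)) \<and>
     C_k k (partial_x f) \<and> C_k k (partial_y f)"

definition Cc_infinity :: "(real \<times> real \<Rightarrow> real) set" where
  "Cc_infinity = {f. (\<forall>k. C_k k f) \<and> compact (closure {p. f p \<noteq> 0})}"

definition locally_integrable :: "(real \<times> real \<Rightarrow> real) \<Rightarrow> bool" where
  "locally_integrable f \<longleftrightarrow> (\<forall>K. compact K \<longrightarrow> set_integrable lebesgue K f)"

definition has_weak_partial_x ::
    "(real \<times> real \<Rightarrow> real) \<Rightarrow> (real \<times> real \<Rightarrow> real) \<Rightarrow> bool" where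
  "has_weak_partial_x f g \<longleftrightarrow> locally_integrable f \<and> locally_integrable g \<and>
     (\<forall>\<phi>\<in>Cc_infinity.
        (LINT p|lebesgue. f p * partial_x \<phi> p) = - (LINT p|lebesgue. g p * \<phi> p))"

definition has_weak_partial_y ::
    "(real \<times> real \<Rightarrow> real) \<Rightarrow> (real \<times> real \<Rightarrow> real) \<Rightarrow> bool" where
  "has_weak_partial_y f g \<longleftrightarrow> locally_integrable f \<and> locally_integrable g \<and>
     (\<forall>\<phi>\<in>Cc_infinity.
        (LINT p|lebesgue. f p * partial_y \<phi> p) = - (LINT p|lebesgue. g p * \<phi> p))"

definition grid :: "real \<Rightarrow> nat \<Rightarrow> nat \<Rightarrow> real" where
  "grid L N k = - L + real k * (2 * L / real N)"

(* Both a_{i,j} (for f the density) and W_{i,j} (for f the function omega). *)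
definition cell_average :: "(real \<times> real \<Rightarrow> real) \<Rightarrow> real \<Rightarrow> nat \<Rightarrow> nat \<Rightarrow> nat \<Rightarrow> real" where
  "cell_average f L N i j =
     (real N)\<^sup>2 / (4 * L\<^sup>2) *
     (LINT p:{grid L N i..grid L N (Suc i)} \<times> {grid L N j..grid L N (Suc j)}|lebesgue. f p)"

definition rho_hat :: "(real \<times> real \<Rightarrow> real) \<Rightarrow> real \<Rightarrow> nat \<Rightarrow> real \<times> real \<Rightarrow> real" where
  "rho_hat \<rho> L N = (\<lambda>(x, y). \<Sum>i<N. \<Sum>j<N.
     cell_average \<rho> L N i j *
     indicat_real {grid L N i..<grid L N (Suc i)} x *
     indicat_real {grid L N j..<grid L N (Suc j)} y)"

definition rho_omega_hat ::
    "(real \<times> real \<Rightarrow> real) \<Rightarrow> (real \<times> real \<Rightarrow> real) \<Rightarrow> real \<Rightarrow> nat \<Rightarrow> real \<times> real \<Rightarrow> real" where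
  "rho_omega_hat \<rho> \<omega> L N = (\<lambda>(x, y). \<Sum>i<N. \<Sum>j<N.
     cell_average \<rho> L N i j * cell_average \<omega> L N i j *
     indicat_real {grid L N i..<grid L N (Suc i)} x *
     indicat_real {grid L N j..<grid L N (Suc j)} y)"

(* gx and gy stand for the weak partial derivatives of rho. *)
definition C_const ::
    "real \<Rightarrow> (real \<times> real \<Rightarrow> real) \<Rightarrow> (real \<times> real \<Rightarrow> real) \<Rightarrow> (real \<times> real \<Rightarrow> real) \<Rightarrow> real" where
  "C_const L gx gy \<phi> =
     16 * L ^ 4 * (Linf_norm gx + Linf_norm gy) *
     (Linf_norm (partial_x \<phi>) + Linf_norm (partial_y \<phi>))"

(* hx and hy stand for the weak partial derivatives of omega. *)
definition K_const ::
    "real \<Rightarrow> (real \<times> real \<Rightarrow> real) \<Rightarrow> (real \<times> real \<Rightarrow> real) \<Rightarrow> (real \<times> real \<Rightarrow> real) \<Rightarrow>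
     (real \<times> real \<Rightarrow> real) \<Rightarrow> real" where
  "K_const L hx hy \<rho> \<phi> =
     2 * L * (Linf_norm hx + Linf_norm hy) * Linf_norm \<phi> * L1_norm \<rho>"

end

theory Submission
  imports Defs
begin

text \<open>
  On a grid cell of side \<open>h = 2 L / N\<close> the density differs from its average \<open>a\<close> by at most
  \<open>h\<close> times the bound on its gradient, and the average of \<open>a - \<rho>\<close> over the cell vanishes. Hence
  a constant may be subtracted from the test function at no cost, and
  \<open>\<integral> (a - \<rho>) \<phi> = \<integral> (a - \<rho>) (\<phi> - \<phi>(corner))\<close> is a product of two factors of size \<open>O(h)\<close> integrated
  over area \<open>h\<^sup>2\<close>: it is at most \<open>h ^ 4\<close> times the two gradient bounds (\<open>covariance_bound\<close>,
  \<open>cell_error\<close>). The \<open>N\<^sup>2\<close> cells together contribute \<open>C / N\<^sup>2\<close>, and the complement of the square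
  contributes at most \<open>\<epsilon> \<parallel>\<phi>\<parallel>\<close>. For the product with \<open>\<omega>\<close>, write
  \<open>a W - \<rho> \<omega> = W (a - \<rho>) + \<rho> (W - \<omega>)\<close>. The first term is the previous one times \<open>W\<close>; in the second
  the oscillation of \<open>\<omega>\<close> is integrated against \<open>\<rho> \<phi>\<close>, without any cancellation, so it yields one power of
  \<open>1 / N\<close> times the total mass.

  What needs work is the oscillation bound, because the derivatives are weak: a function with
  bounded weak derivatives has to be shown to be Lipschitz almost everywhere. Let \<open>\<eta>\<close> be a bump
  with antiderivative \<open>H\<close>. The function \<open>u(x) = H(x) - H(x - t)\<close> is a test function with derivative
  \<open>\<eta>(x) - \<eta>(x - t)\<close> and integral \<open>t \<integral>\<eta>\<close>, so testing the weak derivative against \<open>u(x) v(y)\<close> bounds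
  \<open>\<integral> (f(x,y) - f(x+t,y)) \<eta>(x) v(y)\<close> by \<open>t \<parallel>\<partial>\<^sub>x f\<parallel>\<close> times the area of the supporting box
  (\<open>weak_derivative_tested_difference\<close>). Letting the bumps increase to indicators gives the same
  bound for integrals over boxes, and a function with nonnegative integral over every box is
  nonnegative almost everywhere (\<open>AE_nonneg_if_box_integrals_nonneg\<close>); thus
  \<open>\<bar>f(p + (t,0)) - f(p)\<bar> \<le> t \<parallel>\<partial>\<^sub>x f\<parallel>\<close> for almost every \<open>p\<close>. The exceptional set depends on the shift.
  Fubini's theorem exchanges the quantifiers: for almost every \<open>p\<close> the Lipschitz estimate holds
  for almost every second point, and averaging over that point compares \<open>f(p)\<close> with the cell
  average (\<open>cell_average_deviation\<close>).

  Only products of one-variable functions serve as test functions, and the weak identities are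
  moved to Borel representatives, for which Lebesgue measure is a product measure.
\<close>

section \<open>Nonnegativity from box integrals\<close>

lemma AE_lborel_translate:
  fixes c :: "'a::euclidean_space"
  assumes "AE x in lborel. P x"
  shows "AE x in lborel. P (x + c)"
proof -
  obtain N where N: "N \<in> null_sets lborel" "{x. \<not> P x} \<subseteq> N"
    using assms by (auto simp: eventually_ae_filter)
  have "{x. x - (- c) \<in> N} \<in> null_sets lborel"
    by (rule null_sets_translation[OF N(1)])
  moreover have "{x \<in> space lborel. \<not> P (x + c)} \<subseteq> {x. x - (- c) \<in> N}"
    using N(2) by auto
  ultimately show ?thesis by (rule AE_I')
qed

text \<open>
  Inside a large box, the positive and the negative part of \<open>F\<close> are densities of finite measures
  \<open>P\<close> and \<open>M\<close> with \<open>M \<le> P\<close> on boxes. An open set is, up to a null set, a countable disjoint union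
  of boxes, so \<open>M \<le> P\<close> on open sets, and by outer regularity of \<open>P\<close> on every Borel set. On
  \<open>{F < 0}\<close> the measure \<open>P\<close> vanishes, hence so does \<open>M\<close>.
\<close>

lemma AE_nonneg_if_box_integrals_nonneg:
  fixes F :: "'a::euclidean_space \<Rightarrow> real"
  assumes F [measurable]: "F \<in> borel_measurable borel"
    and int: "\<And>a b. set_integrable lborel (box a b) F"
    and nn: "\<And>a b. 0 \<le> (LINT x:box a b|lborel. F x)"
  shows "AE x in lborel. 0 \<le> F x"
proof -
  have box_le: "(\<integral>\<^sup>+x. ennreal (- F x) * indicator (box a b) x \<partial>lborel)
      \<le> (\<integral>\<^sup>+x. ennreal (F x) * indicator (box a b) x \<partial>lborel)" (is "?M \<le> ?P") for a b
  proof -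
    let ?f = "\<lambda>x. indicator (box a b) x *\<^sub>R F x"
    have i: "integrable lborel ?f" using int[of a b] by (simp add: set_integrable_def)
    have P: "?P = (\<integral>\<^sup>+x. ennreal (?f x) \<partial>lborel)"
      by (intro nn_integral_cong) (auto simp: indicator_def)
    have M: "?M = (\<integral>\<^sup>+x. ennreal (- ?f x) \<partial>lborel)"
      by (intro nn_integral_cong) (auto simp: indicator_def)
    have fin: "?P \<noteq> \<infinity>" "?M \<noteq> \<infinity>"
      using i unfolding P M real_integrable_def by auto
    have "0 \<le> enn2real ?P - enn2real ?M"
      using nn[of a b] real_lebesgue_integral_def[OF i]
      unfolding P M set_lebesgue_integral_def by simp
    then show ?thesis using fin
      by (cases ?P; cases ?M) auto
  qed
  have "AE x in lborel. x \<in> box (- real n *\<^sub>R One) (real n *\<^sub>R One) \<longrightarrow> 0 \<le> F x" for n :: nat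
  proof (cases "n = 0")
    case True then show ?thesis by simp
  next
    case False
    define B where "B = box (- real n *\<^sub>R One :: 'a) (real n *\<^sub>R One)"
    have B [measurable]: "B \<in> sets borel" by (simp add: B_def)
    define P where "P = density lborel (\<lambda>x. ennreal (F x) * indicator B x)"
    define M where "M = density lborel (\<lambda>x. ennreal (- F x) * indicator B x)"
    have emP: "emeasure P S = (\<integral>\<^sup>+x. ennreal (F x) * indicator (S \<inter> B) x \<partial>lborel)"
      if "S \<in> sets borel" for S
      unfolding P_def using that
      by (subst emeasure_density) (auto intro!: nn_integral_cong simp: indicator_def)
    have emM: "emeasure M S = (\<integral>\<^sup>+x. ennreal (- F x) * indicator (S \<inter> B) x \<partial>lborel)"
      if "S \<in> sets borel" for S
      unfolding M_def using that
      by (subst emeasure_density) (auto intro!: nn_integral_cong simp: indicator_def)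
    have box: "emeasure M (box a b) \<le> emeasure P (box a b)" for a b
      unfolding emP[OF borel_open[OF open_box]] emM[OF borel_open[OF open_box]] B_def box_Int_box
      by (rule box_le)
    have fin: "emeasure P S \<noteq> \<infinity>" "emeasure M S \<noteq> \<infinity>" if "S \<in> sets borel" for S
    proof -
      let ?f = "\<lambda>x. indicator B x *\<^sub>R F x"
      have i: "integrable lborel ?f" using int unfolding B_def set_integrable_def by blast
      have "emeasure P S \<le> (\<integral>\<^sup>+x. ennreal (?f x) \<partial>lborel)"
        unfolding emP[OF that] by (intro nn_integral_mono) (auto simp: indicator_def)
      moreover have "emeasure M S \<le> (\<integral>\<^sup>+x. ennreal (- ?f x) \<partial>lborel)"
        unfolding emM[OF that] by (intro nn_integral_mono) (auto simp: indicator_def)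
      ultimately show "emeasure P S \<noteq> \<infinity>" "emeasure M S \<noteq> \<infinity>"
        using i unfolding real_integrable_def by (auto simp: top_unique)
    qed
    have "open S \<Longrightarrow> emeasure M S \<le> emeasure P S" for S
    proof -
      assume "open S"
      define U where "U = S \<inter> B"
      have "open U" unfolding U_def B_def by (intro open_Int open_box \<open>open S\<close>)
      \<comment> \<open>With this gauge every box of the covering is contained in the open set \<open>U\<close>.\<close>
      define g where "g x = (if x \<in> U then U else UNIV)" for x
      have "gauge g" using \<open>open U\<close> by (auto simp: gauge_def g_def)
      have Usub: "U \<subseteq> cbox (- real n *\<^sub>R One) (real n *\<^sub>R One)"
        unfolding U_def B_def using box_subset_cbox by blast
      have ne: "box (- real n *\<^sub>R One :: 'a) (real n *\<^sub>R One) \<noteq> {}"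
        using False by (auto simp: box_ne_empty)
      obtain D where D: "countable D"
          "\<And>K. K \<in> D \<Longrightarrow> interior K \<noteq> {} \<and> (\<exists>c d. K = cbox c d)"
          "pairwise (\<lambda>A B. interior A \<inter> interior B = {}) D"
          "\<And>K. K \<in> D \<Longrightarrow> \<exists>x \<in> U \<inter> K. K \<subseteq> g x" "U \<subseteq> \<Union>D"
      proof (rule covering_lemma[OF Usub ne \<open>gauge g\<close>], goal_cases)
        case (1 D)
        show ?case by (rule 1(1)[OF 1(2,4,5,6,8)])
      qed
      have "K \<subseteq> U" if "K \<in> D" for K using D(4)[OF that] by (auto simp: g_def)
      then have DU: "\<Union>D = U" using D(5) by blast
      have "AE x in lborel. \<forall>K\<in>D. x \<in> K \<longleftrightarrow> x \<in> interior K"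
      proof (intro AE_ball_countable'[OF _ D(1)])
        fix K assume "K \<in> D"
        then obtain c d where K: "K = cbox c d" using D(2) by blast
        have "AE x in lborel. x \<notin> cbox c d - box c d"
          by (intro AE_not_in null_sets_cbox_Diff_box)
        then show "AE x in lborel. x \<in> K \<longleftrightarrow> x \<in> interior K"
          unfolding K using box_subset_cbox[of c d] by (auto elim!: eventually_mono)
      qed
      then have AE: "AE x in lborel. x \<in> U \<longleftrightarrow> x \<in> (\<Union>K\<in>D. interior K)"
        unfolding DU[symmetric] by eventually_elim auto
      have [measurable]: "(\<Union>K\<in>D. interior K) \<in> sets borel" "S \<in> sets borel"
        using \<open>open S\<close> by (auto intro!: borel_open)
      have eqs: "emeasure M S = emeasure M (\<Union>K\<in>D. interior K)"
           "emeasure P S = emeasure P (\<Union>K\<in>D. interior K)"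
      proof -
        have sub: "(\<Union>K\<in>D. interior K) \<subseteq> B" "U \<subseteq> B"
        proof -
          show "U \<subseteq> B" unfolding U_def by (rule Int_lower2)
          have "(\<Union>K\<in>D. interior K) \<subseteq> \<Union>D" by (rule UN_least) (meson Union_upper interior_subset order_trans)
          then show "(\<Union>K\<in>D. interior K) \<subseteq> B" unfolding DU using \<open>U \<subseteq> B\<close> by (rule order_trans)
        qed
        show "emeasure M S = emeasure M (\<Union>K\<in>D. interior K)"
          unfolding emM[OF \<open>S \<in> sets borel\<close>] emM[OF \<open>(\<Union>K\<in>D. interior K) \<in> sets borel\<close>]
          using AE sub unfolding U_def[symmetric]
          by (intro nn_integral_cong_AE) (auto elim!: eventually_mono simp: indicator_def)
        show "emeasure P S = emeasure P (\<Union>K\<in>D. interior K)"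
          unfolding emP[OF \<open>S \<in> sets borel\<close>] emP[OF \<open>(\<Union>K\<in>D. interior K) \<in> sets borel\<close>]
          using AE sub unfolding U_def[symmetric]
          by (intro nn_integral_cong_AE) (auto elim!: eventually_mono simp: indicator_def)
      qed
      have disj: "disjoint_family_on interior D"
        using D(3) by (auto simp: disjoint_family_on_def pairwise_def)
      show "emeasure M S \<le> emeasure P S"
      proof -
        have le: "emeasure M (interior K) \<le> emeasure P (interior K)" if K: "K \<in> D" for K
        proof -
          obtain c d where "K = cbox c d" using D(2)[OF K] by blast
          then show ?thesis by (simp add: box interior_cbox)
        qed
        have "emeasure M (\<Union>K\<in>D. interior K) = (\<integral>\<^sup>+K. emeasure M (interior K) \<partial>count_space D)"
          by (intro emeasure_UN_countable disj D(1)) (simp add: M_def)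
        also have "\<dots> \<le> (\<integral>\<^sup>+K. emeasure P (interior K) \<partial>count_space D)"
          by (intro nn_integral_mono) (simp add: le)
        also have "\<dots> = emeasure P (\<Union>K\<in>D. interior K)"
          by (intro emeasure_UN_countable[symmetric] disj D(1)) (simp add: P_def)
        finally show ?thesis unfolding eqs .
      qed
    qed
    note open_le = this
    define E where "E = {x. F x < 0}"
    have E [measurable]: "E \<in> sets borel" unfolding E_def by measurable
    have "emeasure M E \<le> emeasure P E"
    proof -
      have "emeasure P E = (INF U \<in> {U. E \<subseteq> U \<and> open U}. emeasure P U)"
        by (rule outer_regular) (use fin in \<open>auto simp: P_def\<close>)
      moreover have "emeasure M E \<le> emeasure P U" if "E \<subseteq> U" "open U" for U
      proof -
        have "emeasure M E \<le> emeasure M U"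
          using that by (intro emeasure_mono) (auto simp: M_def)
        then show ?thesis using open_le[OF that(2)] by simp
      qed
      ultimately show ?thesis by (auto intro: INF_greatest)
    qed
    also have "emeasure P E = 0"
      unfolding emP[OF E] by (auto simp: E_def indicator_def nn_integral_0_iff_AE ennreal_neg)
    finally have "(\<integral>\<^sup>+x. ennreal (- F x) * indicator (E \<inter> B) x \<partial>lborel) = 0"
      unfolding emM[OF E] by simp
    then have "AE x in lborel. ennreal (- F x) * indicator (E \<inter> B) x = 0"
      by (subst (asm) nn_integral_0_iff_AE) auto
    then show ?thesis
      unfolding B_def[symmetric] by eventually_elim (auto simp: E_def indicator_def ennreal_eq_0_iff split: if_splits)
  qed
  then have "AE x in lborel. \<forall>n::nat. x \<in> box (- real n *\<^sub>R One) (real n *\<^sub>R One) \<longrightarrow> 0 \<le> F x"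
    unfolding AE_all_countable by blast
  then show ?thesis
  proof eventually_elim
    case (elim x)
    obtain n :: nat where n: "norm x < real n" using reals_Archimedean2 by blast
    have "\<bar>x \<bullet> i\<bar> < real n" if "i \<in> Basis" for i
      using Basis_le_norm[OF that, of x] n by linarith
    then have "x \<in> box (- real n *\<^sub>R One) (real n *\<^sub>R One)"
      by (auto simp: mem_box abs_less_iff inner_simps minus_less_iff)
    then show ?case using elim by blast
  qed
qed

section \<open>Smooth bumps and product test functions\<close>

text \<open>
  One-variable counterpart of \<open>C_k\<close>. The derivative is quantified existentially so that the
  closure properties follow by induction without evaluating \<open>deriv\<close>.
\<close>

primrec smooth_upto :: "nat \<Rightarrow> (real \<Rightarrow> real) \<Rightarrow> bool" where
  "smooth_upto 0 u \<longleftrightarrow> continuous_on UNIV u"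
| "smooth_upto (Suc k) u \<longleftrightarrow>
     (\<exists>u'. (\<forall>x. (u has_real_derivative u' x) (at x)) \<and> smooth_upto k u')"

lemma smooth_upto_Suc_imp: "smooth_upto (Suc k) u \<Longrightarrow> smooth_upto k u"
proof (induction k arbitrary: u)
  case 0
  then obtain u' where "\<And>x. (u has_real_derivative u' x) (at x)" by auto
  then show ?case by (auto intro: DERIV_continuous_on has_field_derivative_at_within)
next
  case (Suc k)
  from Suc.prems obtain u' where "\<forall>x. (u has_real_derivative u' x) (at x)" "smooth_upto (Suc k) u'"
    unfolding smooth_upto.simps(2)[of "Suc k"] by blast
  then show ?case using Suc.IH[of u'] unfolding smooth_upto.simps(2)[of k u] by blast
qed

lemma smooth_upto_add: "smooth_upto k u \<Longrightarrow> smooth_upto k v \<Longrightarrow> smooth_upto k (\<lambda>x. u x + v x)"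
proof (induction k arbitrary: u v)
  case (Suc k)
  from Suc.prems obtain u' v' where
    "\<forall>x. (u has_real_derivative u' x) (at x)" "smooth_upto k u'"
    "\<forall>x. (v has_real_derivative v' x) (at x)" "smooth_upto k v'" by auto
  then show ?case using Suc.IH by (auto intro!: exI[of _ "\<lambda>x. u' x + v' x"] derivative_intros)
qed (auto intro: continuous_on_add)

lemma smooth_upto_mult: "smooth_upto k u \<Longrightarrow> smooth_upto k v \<Longrightarrow> smooth_upto k (\<lambda>x. u x * v x)"
proof (induction k arbitrary: u v)
  case (Suc k)
  from Suc.prems obtain u' v' where
    d: "\<forall>x. (u has_real_derivative u' x) (at x)" "smooth_upto k u'"
    "\<forall>x. (v has_real_derivative v' x) (at x)" "smooth_upto k v'" by auto
  have "smooth_upto k (\<lambda>x. u' x * v x + v' x * u x)"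
    using Suc.prems[THEN smooth_upto_Suc_imp] d by (intro smooth_upto_add Suc.IH)
  then show ?case using d by (auto intro!: exI[of _ "\<lambda>x. u' x * v x + v' x * u x"] DERIV_mult)
qed (auto intro: continuous_on_mult)

lemma smooth_upto_cmult: "smooth_upto k u \<Longrightarrow> smooth_upto k (\<lambda>x. c * u x)"
proof (induction k arbitrary: u)
  case (Suc k)
  from Suc.prems obtain u' where
    "\<forall>x. (u has_real_derivative u' x) (at x)" "smooth_upto k u'" by auto
  then show ?case using Suc.IH by (auto intro!: exI[of _ "\<lambda>x. c * u' x"] DERIV_cmult)
qed (auto intro: continuous_intros)

lemma smooth_upto_affine: "smooth_upto k u \<Longrightarrow> smooth_upto k (\<lambda>x. u (c * x + d))"
proof (induction k arbitrary: u)
  case (0 u)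
  then show ?case
    by (auto intro!: continuous_on_compose2[of UNIV u] continuous_intros)
next
  case (Suc k)
  from Suc.prems obtain u' where
    d: "\<And>x. (u has_real_derivative u' x) (at x)" "smooth_upto k u'" by auto
  have "((\<lambda>x. u (c * x + d)) has_real_derivative c * u' (c * x + d)) (at x)" for x
    by (rule DERIV_cong[OF DERIV_chain2[OF d(1)]]) (auto intro!: derivative_eq_intros)
  then show ?case
    using smooth_upto_cmult[OF Suc.IH[OF d(2)], of c]
    by (auto intro!: exI[of _ "\<lambda>x. c * u' (c * x + d)"])
qed

definition smooth :: "(real \<Rightarrow> real) \<Rightarrow> bool" where
  "smooth u \<longleftrightarrow> (\<forall>k. smooth_upto k u)"

lemma smooth_antiderivative:
  "(\<And>x. (H has_real_derivative u x) (at x)) \<Longrightarrow> smooth u \<Longrightarrow> smooth H"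
  unfolding smooth_def
proof
  fix k
  assume "\<And>x. (H has_real_derivative u x) (at x)" "\<forall>k. smooth_upto k u"
  then have "smooth_upto (Suc k) H" by auto
  then show "smooth_upto k H" by (rule smooth_upto_Suc_imp)
qed

lemma smooth_diff_translate: "smooth u \<Longrightarrow> smooth (\<lambda>x. u x - u (x - t))"
  using smooth_upto_add[OF _ smooth_upto_cmult[OF smooth_upto_affine[of _ u 1 "-t"], of _ "-1"]]
  by (auto simp: smooth_def)

lemma smooth_imp_continuous: "smooth u \<Longrightarrow> continuous_on UNIV u"
  unfolding smooth_def using smooth_upto.simps(1) by blast

text \<open>
  The family of all functions \<open>p(1/x) exp(-1/x)\<close>, extended by \<open>0\<close> to \<open>x \<le> 0\<close>, is closed under
  differentiation; this is what makes its members smooth at the origin.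
\<close>

definition flat_exp :: "real poly \<Rightarrow> real \<Rightarrow> real" where
  "flat_exp p x = (if 0 < x then poly p (1 / x) * exp (- (1 / x)) else 0)"

lemma poly_over_exp_tendsto_0: "((\<lambda>y. poly p y * exp (- y)) \<longlongrightarrow> (0::real)) at_top"
proof -
  have "((\<lambda>y. \<Sum>i\<le>degree p. coeff p i * (y ^ i / exp y)) \<longlongrightarrow> (\<Sum>i\<le>degree p. coeff p i * 0)) at_top"
    by (intro tendsto_sum tendsto_mult tendsto_const tendsto_power_div_exp_0)
  then show ?thesis
    by (simp add: poly_altdef sum_distrib_right exp_minus divide_inverse mult.assoc)
qed

text \<open>
  At the origin the difference quotient from the right is \<open>y p(y) exp(-y)\<close> with \<open>y = 1/h\<close>, which
  tends to \<open>0\<close>.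
\<close>

lemma flat_exp_has_derivative:
  "(flat_exp p has_real_derivative flat_exp ([:0, 0, 1:] * (p - pderiv p)) x) (at x)"
proof (cases x "0::real" rule: linorder_cases)
  case less
  have "((\<lambda>x. 0) has_real_derivative 0) (at x)" by simp
  then have "(flat_exp p has_real_derivative 0) (at x)"
    by (rule has_field_derivative_transform_within_open[of _ _ _ "{..<0}"])
       (use less in \<open>auto simp: flat_exp_def\<close>)
  then show ?thesis using less by (simp add: flat_exp_def)
next
  case greater
  have inv: "((\<lambda>x. 1 / x) has_real_derivative - (1 / x\<^sup>2)) (at x)"
    using greater by (auto intro!: derivative_eq_intros simp: power2_eq_square)
  have "((\<lambda>x. poly p (1 / x) * exp (- (1 / x))) has_real_derivative
          (poly (pderiv p) (1 / x) * - (1 / x\<^sup>2)) * exp (- (1 / x)) +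
          (exp (- (1 / x)) * - (- (1 / x\<^sup>2))) * poly p (1 / x)) (at x)"
    by (intro DERIV_mult DERIV_chain2[OF poly_DERIV inv] DERIV_chain2[OF DERIV_exp] DERIV_minus inv)
  also have "(poly (pderiv p) (1 / x) * - (1 / x\<^sup>2)) * exp (- (1 / x)) +
          (exp (- (1 / x)) * - (- (1 / x\<^sup>2))) * poly p (1 / x) =
        flat_exp ([:0, 0, 1:] * (p - pderiv p)) x"
    using greater by (simp add: flat_exp_def field_simps power2_eq_square)
  finally have "((\<lambda>x. poly p (1 / x) * exp (- (1 / x))) has_real_derivative
          flat_exp ([:0, 0, 1:] * (p - pderiv p)) x) (at x)" .
  then show ?thesis
    by (rule has_field_derivative_transform_within_open[of _ _ _ "{0<..}"])
       (use greater in \<open>auto simp: flat_exp_def\<close>)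
next
  case equal
  have "((\<lambda>h. flat_exp p h / h) \<longlongrightarrow> 0) (at_left 0)"
    by (rule tendsto_eventually) (auto simp: flat_exp_def eventually_at_filter)
  moreover have "((\<lambda>h. flat_exp p h / h) \<longlongrightarrow> 0) (at_right 0)"
    unfolding filterlim_at_right_to_top
  proof (rule Lim_transform_eventually[OF poly_over_exp_tendsto_0[of "pCons 0 p"]])
    show "\<forall>\<^sub>F y in at_top. poly (pCons 0 p) y * exp (- y) = flat_exp p (inverse y) / inverse y"
      using eventually_gt_at_top[of 0] by eventually_elim (simp add: flat_exp_def field_simps)
  qed
  ultimately show ?thesis
    unfolding equal has_field_derivative_iff
    by (subst filterlim_split_at_real) (simp_all add: flat_exp_def[of _ 0])
qed

lemma smooth_flat_exp: "smooth (flat_exp p)"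
proof -
  have "smooth_upto k (flat_exp p)" for k
  proof (induction k arbitrary: p)
    case 0
    show ?case using flat_exp_has_derivative
      by (auto intro!: DERIV_continuous_on simp: has_field_derivative_at_within)
  next
    case (Suc k)
    show ?case using flat_exp_has_derivative Suc by auto
  qed
  then show ?thesis by (simp add: smooth_def)
qed

text \<open>
  Dilating \<open>exp(-1/x)\<close> makes it increase to the indicator of the positive half-line. A product of
  two such dilates increases to the indicator of an open interval and is supported in that interval.
\<close>

definition bump :: "nat \<Rightarrow> real \<Rightarrow> real \<Rightarrow> real \<Rightarrow> real" where
  "bump n a b x = flat_exp 1 (real (Suc n) * (x - a)) * flat_exp 1 (real (Suc n) * (b - x))"

lemma smooth_bump: "smooth (bump n a b)"
proof -
  have eq: "bump n a b = (\<lambda>x. flat_exp 1 (real (Suc n) * x + (- (real (Suc n) * a))) *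
                           flat_exp 1 ((- real (Suc n)) * x + real (Suc n) * b))"
    by (auto simp: bump_def algebra_simps)
  show ?thesis
    using smooth_flat_exp[of 1] unfolding smooth_def eq
    by (intro allI smooth_upto_mult smooth_upto_affine) auto
qed

lemma bump_nonneg: "0 \<le> bump n a b x"
  by (simp add: bump_def flat_exp_def)

lemma bump_le_indicator: "bump n a b x \<le> indicator {a<..<b} x"
  by (auto simp: bump_def flat_exp_def indicator_def zero_less_mult_iff intro!: mult_le_one)

lemma bump_outside: "x \<le> a \<or> b \<le> x \<Longrightarrow> bump n a b x = 0"
  by (auto simp: bump_def flat_exp_def zero_less_mult_iff)

lemma flat_exp_scale_tendsto: "0 < x \<Longrightarrow> (\<lambda>n. flat_exp 1 (real (Suc n) * x)) \<longlonglongrightarrow> 1"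
proof -
  assume "0 < x"
  have "(\<lambda>n. exp (- (inverse (real (Suc n)) * (1 / x)))) \<longlonglongrightarrow> exp (- (0 * (1 / x)))"
    by (intro tendsto_intros LIMSEQ_inverse_real_of_nat)
  then show ?thesis using \<open>0 < x\<close> by (simp add: flat_exp_def field_simps add_pos_nonneg)
qed

lemma bump_tendsto_indicator: "(\<lambda>n. bump n a b x) \<longlonglongrightarrow> indicator {a<..<b} x"
proof (cases "a < x \<and> x < b")
  case True
  have "(\<lambda>n. bump n a b x) \<longlonglongrightarrow> 1 * 1"
    unfolding bump_def using True by (intro tendsto_mult flat_exp_scale_tendsto) auto
  then show ?thesis using True by simp
next
  case False
  then show ?thesis using bump_outside by (auto simp: not_less)
qed

lemma C_k_product:
  "smooth_upto k u \<Longrightarrow> smooth_upto k v \<Longrightarrow> C_k k (\<lambda>p. u (fst p) * v (snd p))"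
proof (induction k arbitrary: u v)
  case 0
  then have "continuous_on UNIV (\<lambda>p::real \<times> real. u (fst p))"
       "continuous_on UNIV (\<lambda>p::real \<times> real. v (snd p))"
    by (auto intro!: continuous_on_compose2[of UNIV u] continuous_on_compose2[of UNIV v] continuous_intros)
  then show ?case by (auto intro: continuous_on_mult)
next
  case (Suc k)
  from Suc.prems obtain u' v' where
    d: "\<And>x. (u has_real_derivative u' x) (at x)" "smooth_upto k u'"
    "\<And>x. (v has_real_derivative v' x) (at x)" "smooth_upto k v'" by auto
  have x: "((\<lambda>t. u t * c) has_real_derivative u' x * c) (at x)" for x c
    by (rule DERIV_cmult_right[OF d(1)])
  have y: "((\<lambda>t. c * v t) has_real_derivative c * v' x) (at x)" for x c
    by (rule DERIV_cmult[OF d(3)])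
  have "partial_x (\<lambda>p. u (fst p) * v (snd p)) = (\<lambda>p. u' (fst p) * v (snd p))"
    unfolding partial_x_def by (auto simp: DERIV_imp_deriv[OF x])
  moreover have "partial_y (\<lambda>p. u (fst p) * v (snd p)) = (\<lambda>p. u (fst p) * v' (snd p))"
    unfolding partial_y_def by (auto simp: DERIV_imp_deriv[OF y])
  ultimately show ?case
    using x y Suc.IH d(2,4) Suc.prems[THEN smooth_upto_Suc_imp]
    by (simp add: real_differentiable_def) blast
qed

lemma product_in_Cc_infinity:
  assumes "smooth u" "smooth v"
    and "\<And>x. x \<notin> {a..b} \<Longrightarrow> u x = 0" "\<And>y. y \<notin> {c..d} \<Longrightarrow> v y = 0"
  shows "(\<lambda>p. u (fst p) * v (snd p)) \<in> Cc_infinity"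
proof -
  have "{p. u (fst p) * v (snd p) \<noteq> 0} \<subseteq> {a..b} \<times> {c..d}"
    using assms(3,4) by fastforce
  then have "bounded {p. u (fst p) * v (snd p) \<noteq> 0}"
    by (rule bounded_subset[rotated]) (intro bounded_Times bounded_closed_interval)
  then show ?thesis
    using C_k_product assms(1,2) by (auto simp: Cc_infinity_def compact_closure smooth_def)
qed

section \<open>From a weak derivative to difference quotients\<close>

lemma continuous_has_antiderivative:
  fixes f :: "real \<Rightarrow> real"
  assumes "continuous_on UNIV f"
  obtains F where "\<And>x. (F has_real_derivative f x) (at x)"
proof -
  have "\<exists>F. \<forall>x. - \<infinity> < ereal x \<longrightarrow> ereal x < \<infinity> \<longrightarrow> (F has_vector_derivative f x) (at x)"
    using assms by (intro einterval_antiderivative) (auto simp: continuous_on_eq_continuous_at)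
  then show ?thesis using that by (auto simp: has_real_derivative_iff_has_vector_derivative)
qed

text \<open>
  With an antiderivative \<open>H\<close> of \<open>\<eta>\<close>, take \<open>u(x) = H(x) - H(x - t)\<close>: it has compact support because \<open>H\<close>
  is constant on both sides of \<open>[a, b]\<close>. Its integral is \<open>t (H(b) - H(a))\<close>, read off from an
  antiderivative \<open>G\<close> of \<open>H\<close>, which is affine on both sides of \<open>[a, b]\<close>.
\<close>

lemma translation_difference_kernel:
  fixes \<eta> :: "real \<Rightarrow> real"
  assumes "smooth \<eta>" and \<eta>01: "\<And>x. 0 \<le> \<eta> x" "\<And>x. \<eta> x \<le> 1"
    and supp: "\<And>x. x \<notin> {a..b} \<Longrightarrow> \<eta> x = 0" and "a < b" "0 < t"
  obtains u where "smooth u" "\<And>x. (u has_real_derivative \<eta> x - \<eta> (x - t)) (at x)"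
    "\<And>x. 0 \<le> u x" "\<And>x. x \<notin> {a..b+t} \<Longrightarrow> u x = 0"
    "(\<integral>\<^sup>+x. ennreal (u x) \<partial>lborel) \<le> ennreal (t * (b - a))"
proof -
  obtain H where H: "\<And>x. (H has_real_derivative \<eta> x) (at x)"
    using continuous_has_antiderivative smooth_imp_continuous[OF \<open>smooth \<eta>\<close>] by blast
  have smH: "smooth H" using H \<open>smooth \<eta>\<close> by (rule smooth_antiderivative)
  obtain G where G: "\<And>x. (G has_real_derivative H x) (at x)"
    using continuous_has_antiderivative smooth_imp_continuous[OF smH] by blast
  have mono: "H x \<le> H y" if "x \<le> y" for x y
    using that H \<eta>01(1) by (auto intro: DERIV_nonneg_imp_nondecreasing)
  have low: "H x = H a" if "x \<le> a" for x
  proof (cases "x = a")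
    case False
    then have "x < a" using that by simp
    then obtain z where "x < z" "z < a" "H a - H x = (a - x) * \<eta> z"
      using MVT2[of x a H \<eta>] H by blast
    then show ?thesis using supp[of z] by simp
  qed simp
  have high: "H x = H b" if "b \<le> x" for x
  proof (cases "x = b")
    case False
    then have "b < x" using that by simp
    then obtain z where "b < z" "z < x" "H x - H b = (x - b) * \<eta> z"
      using MVT2[of b x H \<eta>] H by blast
    then show ?thesis using supp[of z] by simp
  qed simp
  have total: "H b - H a \<le> b - a"
  proof -
    obtain z where "H b - H a = (b - a) * \<eta> z"
      using MVT2[of a b H \<eta>] H \<open>a < b\<close> by blast
    then show ?thesis using \<eta>01(2)[of z] \<open>a < b\<close> by (simp add: mult_left_le)
  qed
  define u where "u x = H x - H (x - t)" for x
  have shift: "((\<lambda>x. F (x - t)) has_real_derivative f (x - t)) (at x)"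
    if "\<And>x. (F has_real_derivative f x) (at x)" for F f :: "real \<Rightarrow> real" and x
    by (rule DERIV_cong[OF DERIV_chain2[OF that]]) (auto intro!: derivative_eq_intros)
  have smu: "smooth u" unfolding u_def by (rule smooth_diff_translate[OF smH])
  have du: "(u has_real_derivative \<eta> x - \<eta> (x - t)) (at x)" for x
    unfolding u_def by (intro DERIV_diff H shift)
  have u0: "0 \<le> u x" for x using mono[of "x - t" x] \<open>0 < t\<close> by (simp add: u_def)
  have usupp: "u x = 0" if "x \<notin> {a..b+t}" for x
  proof -
    from that consider "x < a" | "b + t < x" by fastforce
    then show ?thesis
    proof cases
      case 1 then show ?thesis using low[of x] low[of "x - t"] \<open>0 < t\<close> by (simp add: u_def)
    next
      case 2 then show ?thesis using high[of x] high[of "x - t"] \<open>0 < t\<close> by (simp add: u_def)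
    qed
  qed
  have "(\<integral>\<^sup>+x. ennreal (u x) \<partial>lborel) = (\<integral>\<^sup>+x. ennreal (u x) * indicator {a..b+t} x \<partial>lborel)"
    using usupp by (intro nn_integral_cong) (auto simp: indicator_def)
  also have "\<dots> = ennreal ((G (b + t) - G (b + t - t)) - (G a - G (a - t)))"
  proof (rule nn_integral_FTC_Icc)
    show "u \<in> borel_measurable borel"
      using smooth_imp_continuous[OF smu] by (rule borel_measurable_continuous_onI)
    show "((\<lambda>x. G x - G (x - t)) has_real_derivative u x) (at x)" for x
      unfolding u_def by (intro DERIV_diff G shift)
  qed (use u0 \<open>a < b\<close> \<open>0 < t\<close> in auto)
  also have "\<dots> \<le> ennreal (t * (b - a))"
  proof (rule ennreal_leI)
    obtain z where "b < z" "G (b + t) - G b = (b + t - b) * H z"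
      using MVT2[of b "b + t" G H] G \<open>0 < t\<close> by force
    moreover obtain w where "w < a" "G a - G (a - t) = (a - (a - t)) * H w"
      using MVT2[of "a - t" a G H] G \<open>0 < t\<close> by force
    ultimately have "(G (b + t) - G (b + t - t)) - (G a - G (a - t)) = t * (H b - H a)"
      using high[of z] low[of w] by (simp add: algebra_simps)
    also have "\<dots> \<le> t * (b - a)" using total \<open>0 < t\<close> by simp
    finally show "(G (b + t) - G (b + t - t)) - (G a - G (a - t)) \<le> t * (b - a)" .
  qed
  finally show ?thesis using that smu du u0 usupp by blast
qed

lemma integrable_mult_compact_support:
  fixes f w :: "'a::euclidean_space \<Rightarrow> real"
  assumes [measurable]: "f \<in> borel_measurable borel" "w \<in> borel_measurable borel"
    and "set_integrable lborel K f" "\<And>p. \<bar>w p\<bar> \<le> C" "\<And>p. p \<notin> K \<Longrightarrow> w p = 0"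
  shows "integrable lborel (\<lambda>p. f p * w p)"
proof (rule Bochner_Integration.integrable_bound)
  show "integrable lborel (\<lambda>p. C * (indicator K p *\<^sub>R f p))"
    using assms(3) unfolding set_integrable_def by (rule integrable_mult_right)
  have "norm (f p * w p) \<le> norm (C * (indicator K p *\<^sub>R f p))" for p
  proof (cases "p \<in> K")
    case True
    have "\<bar>f p\<bar> * \<bar>w p\<bar> \<le> \<bar>f p\<bar> * \<bar>C\<bar>"
      using assms(4)[of p] by (intro mult_left_mono) linarith+
    then show ?thesis using True by (simp add: abs_mult mult.commute)
  qed (simp add: assms(5))
  then show "AE p in lborel. norm (f p * w p) \<le> norm (C * (indicator K p *\<^sub>R f p))" by simp
qed simp

lemma lborel_integral_translate:
  fixes f :: "'a::euclidean_space \<Rightarrow> real"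
  assumes [measurable]: "f \<in> borel_measurable borel"
  shows "(LINT p|lborel. f (p + c)) = (LINT p|lborel. f p)"
    and "integrable lborel (\<lambda>p. f (p + c)) \<longleftrightarrow> integrable lborel f"
proof -
  have "(LINT p|lborel. f p) = (LINT p|distr lborel borel ((+) c). f p)"
    by (simp add: lborel_distr_plus)
  also have "\<dots> = (LINT p|lborel. f (c + p))" by (rule integral_distr) auto
  finally show "(LINT p|lborel. f (p + c)) = (LINT p|lborel. f p)" by (simp add: add.commute)
  have "integrable lborel f \<longleftrightarrow> integrable (distr lborel borel ((+) c)) f"
    by (simp add: lborel_distr_plus)
  also have "\<dots> \<longleftrightarrow> integrable lborel (\<lambda>p. f (c + p))" by (rule integrable_distr_eq) auto
  finally show "integrable lborel (\<lambda>p. f (p + c)) \<longleftrightarrow> integrable lborel f"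
    by (simp add: add.commute)
qed

lemma borel_measurable_fst_snd [measurable]:
  "(fst :: real \<times> real \<Rightarrow> real) \<in> borel_measurable borel"
  "(snd :: real \<times> real \<Rightarrow> real) \<in> borel_measurable borel"
  by (intro borel_measurable_continuous_onI continuous_intros)+

lemma nn_integral_product:
  fixes u v :: "real \<Rightarrow> ennreal"
  assumes [measurable]: "u \<in> borel_measurable borel" "v \<in> borel_measurable borel"
  shows "(\<integral>\<^sup>+p. u (fst p) * v (snd p) \<partial>lborel) = (\<integral>\<^sup>+x. u x \<partial>lborel) * (\<integral>\<^sup>+y. v y \<partial>lborel)"
proof -
  have "(\<integral>\<^sup>+p. u (fst p) * v (snd p) \<partial>lborel) = (\<integral>\<^sup>+p. u (fst p) * v (snd p) \<partial>(lborel \<Otimes>\<^sub>M lborel))"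
    by (simp add: lborel_prod)
  also have "\<dots> = (\<integral>\<^sup>+x. \<integral>\<^sup>+y. u (fst (x, y)) * v (snd (x, y)) \<partial>lborel \<partial>lborel)"
    by (rule lborel.nn_integral_fst[symmetric]) measurable
  also have "\<dots> = (\<integral>\<^sup>+x. u x * (\<integral>\<^sup>+y. v y \<partial>lborel) \<partial>lborel)"
    by (simp add: nn_integral_cmult)
  also have "\<dots> = (\<integral>\<^sup>+x. u x \<partial>lborel) * (\<integral>\<^sup>+y. v y \<partial>lborel)"
    by (simp add: nn_integral_multc)
  finally show ?thesis .
qed

text \<open>
  The factor \<open>\<eta>(x) - \<eta>(x - t)\<close> is the derivative of the kernel \<open>u\<close> above, so the weak identity
  turns the left-hand side into \<open>\<integral> g u v\<close>, which is at most \<open>A (d - c) \<integral>u\<close>. The hypothesis \<open>test\<close> is the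
  weak identity for product test functions; after a swap of the coordinates the partial derivative
  in the second variable has this form too.
\<close>

lemma weak_derivative_tested_difference:
  fixes f g :: "real \<times> real \<Rightarrow> real" and \<eta> v :: "real \<Rightarrow> real"
  assumes [measurable]: "g \<in> borel_measurable borel"
    and "0 \<le> A" and A: "AE p in lborel. \<bar>g p\<bar> \<le> A"
    and test: "\<And>u u' v a b c d. \<lbrakk>smooth u; \<And>x. (u has_real_derivative u' x) (at x); smooth v;
        \<And>x. x \<notin> {a..b} \<Longrightarrow> u x = 0; \<And>y. y \<notin> {c..d} \<Longrightarrow> v y = 0\<rbrakk> \<Longrightarrow>
        (LINT p|lborel. f p * (u' (fst p) * v (snd p))) =
        - (LINT p|lborel. g p * (u (fst p) * v (snd p)))"
    and "smooth \<eta>" "\<And>x. 0 \<le> \<eta> x" "\<And>x. \<eta> x \<le> 1" "\<And>x. x \<notin> {a..b} \<Longrightarrow> \<eta> x = 0"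
    and "smooth v" and v01: "\<And>x. 0 \<le> v x" "\<And>x. v x \<le> 1" and vs: "\<And>x. x \<notin> {c..d} \<Longrightarrow> v x = 0"
    and "a < b" "c < d" "0 < t"
  shows "\<bar>LINT p|lborel. f p * ((\<eta> (fst p) - \<eta> (fst p - t)) * v (snd p))\<bar> \<le> A * (t * (b - a) * (d - c))"
proof -
  obtain u where u: "smooth u" "\<And>x. (u has_real_derivative \<eta> x - \<eta> (x - t)) (at x)"
    "\<And>x. 0 \<le> u x" "\<And>x. x \<notin> {a..b+t} \<Longrightarrow> u x = 0"
    "(\<integral>\<^sup>+x. ennreal (u x) \<partial>lborel) \<le> ennreal (t * (b - a))"
    using translation_difference_kernel[of \<eta> a b t] assms by blast
  have [measurable]: "u \<in> borel_measurable borel" "v \<in> borel_measurable borel"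
    using smooth_imp_continuous u(1) \<open>smooth v\<close> by (auto intro: borel_measurable_continuous_onI)
  let ?I = "LINT p|lborel. g p * (u (fst p) * v (snd p))"
  have eq: "(LINT p|lborel. f p * ((\<eta> (fst p) - \<eta> (fst p - t)) * v (snd p))) = - ?I"
    by (rule test[OF u(1,2) \<open>smooth v\<close> u(4) vs])
  have "ennreal \<bar>?I\<bar> \<le> ennreal (A * (t * (b - a) * (d - c)))"
  proof (cases "integrable lborel (\<lambda>p. g p * (u (fst p) * v (snd p)))")
    case True
    have "ennreal (norm ?I) \<le> (\<integral>\<^sup>+p. ennreal (norm (g p * (u (fst p) * v (snd p)))) \<partial>lborel)"
      by (rule integral_norm_bound_ennreal[OF True])
    also have "\<dots> \<le> (\<integral>\<^sup>+p. ennreal A * (ennreal (u (fst p)) * indicator {c..d} (snd p)) \<partial>lborel)"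
      using A
    proof (intro nn_integral_mono_AE, eventually_elim)
      case (elim p)
      have vi: "v (snd p) \<le> indicator {c..d} (snd p)"
        using v01(2)[of "snd p"] vs[of "snd p"] by (simp add: indicator_def)
      have "norm (g p * (u (fst p) * v (snd p))) = \<bar>g p\<bar> * (u (fst p) * v (snd p))"
        using u(3) v01(1) by (simp add: abs_mult)
      also have "\<dots> \<le> A * (u (fst p) * indicator {c..d} (snd p))"
        using elim vi u(3) v01(1) \<open>0 \<le> A\<close> by (intro mult_mono) auto
      finally have "ennreal (norm (g p * (u (fst p) * v (snd p)))) \<le>
          ennreal (A * (u (fst p) * indicator {c..d} (snd p)))" by (rule ennreal_leI)
      also have "\<dots> = ennreal A * (ennreal (u (fst p)) * indicator {c..d} (snd p))"
        using \<open>0 \<le> A\<close> u(3) by (simp add: ennreal_mult ennreal_indicator)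
      finally show ?case .
    qed
    also have "\<dots> = ennreal A * ((\<integral>\<^sup>+x. ennreal (u x) \<partial>lborel) * (\<integral>\<^sup>+y. indicator {c..d} y \<partial>lborel))"
      by (subst nn_integral_cmult) (simp_all add: nn_integral_product[of "\<lambda>x. ennreal (u x)" "indicator {c..d}"])
    also have "\<dots> \<le> ennreal A * (ennreal (t * (b - a)) * ennreal (d - c))"
      using \<open>c < d\<close> by (intro mult_left_mono mult_mono u(5)) auto
    also have "\<dots> = ennreal (A * (t * (b - a) * (d - c)))"
      using \<open>0 \<le> A\<close> \<open>c < d\<close> \<open>a < b\<close> \<open>0 < t\<close> by (simp add: ennreal_mult)
    finally show ?thesis by simp
  qed (simp add: not_integrable_integral_eq)
  then show ?thesis unfolding eq
    using \<open>0 \<le> A\<close> \<open>c < d\<close> \<open>a < b\<close> \<open>0 < t\<close> by simp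
qed

text \<open>
  Translating the variable moves the shift from the bump to \<open>f\<close>, and the bumps converge
  boundedly to the indicator of the box.
\<close>

lemma weak_derivative_box_difference:
  fixes f g :: "real \<times> real \<Rightarrow> real"
  assumes [measurable]: "f \<in> borel_measurable borel" "g \<in> borel_measurable borel"
    and fi: "\<And>K. compact K \<Longrightarrow> set_integrable lborel K f"
    and "0 \<le> A" and A: "AE p in lborel. \<bar>g p\<bar> \<le> A"
    and test: "\<And>u u' v a b c d. \<lbrakk>smooth u; \<And>x. (u has_real_derivative u' x) (at x); smooth v;
        \<And>x. x \<notin> {a..b} \<Longrightarrow> u x = 0; \<And>y. y \<notin> {c..d} \<Longrightarrow> v y = 0\<rbrakk> \<Longrightarrow>
        (LINT p|lborel. f p * (u' (fst p) * v (snd p))) =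
        - (LINT p|lborel. g p * (u (fst p) * v (snd p)))"
    and "a < b" "c < d" "0 < t"
  shows "\<bar>LINT p:box (a, c) (b, d)|lborel. f p - f (p + (t, 0))\<bar> \<le> A * (t * (b - a) * (d - c))"
proof -
  let ?K = "cbox (a, c) (b, d)"
  have fK: "set_integrable lborel ?K f" by (intro fi compact_cbox)
  have iff: "p \<in> box (a, c) (b, d) \<longleftrightarrow> fst p \<in> {a<..<b} \<and> snd p \<in> {c<..<d}" for p
    by (cases p) (simp add: box_prod)
  have fsK: "integrable lborel (\<lambda>p. indicator ?K p *\<^sub>R f (p + (t, 0)))"
  proof -
    have "integrable lborel (\<lambda>p. f p * indicator ?K (p - (t, 0)))"
      by (rule integrable_mult_compact_support[where K = "cbox (a + t, c) (b + t, d)" and C = 1])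
         (auto intro!: fi compact_cbox simp: indicator_def split: if_splits)
    then have "integrable lborel (\<lambda>p. f (p + (t, 0)) * indicator ?K (p + (t, 0) - (t, 0)))"
      by (subst lborel_integral_translate(2)) auto
    then show ?thesis by (simp add: mult.commute)
  qed
  let ?w = "\<lambda>n p. bump n a b (fst p) * bump n c d (snd p)"
  have mb [measurable]: "bump n x y \<in> borel_measurable borel" for n x y
    using smooth_imp_continuous[OF smooth_bump] by (rule borel_measurable_continuous_onI)
  have b1: "bump n x y z \<le> 1" for n x y z
    by (rule order_trans[OF bump_le_indicator]) (simp add: indicator_def)
  have w01: "\<bar>?w n p\<bar> \<le> 1" for n p
    using b1 bump_nonneg by (simp add: abs_mult mult_le_one)
  have wK: "?w n p = 0" if "p \<notin> ?K" for n p
    using that bump_outside[of "fst p" a b n] bump_outside[of "snd p" c d n]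
    by (cases p) (auto simp: not_le)
  have tested: "\<bar>LINT p|lborel. (f p - f (p + (t, 0))) * ?w n p\<bar> \<le> A * (t * (b - a) * (d - c))" for n
  proof -
    have i1: "integrable lborel (\<lambda>p. f p * ?w n p)"
      by (rule integrable_mult_compact_support[OF _ _ fK w01 wK]) auto
    have i2: "integrable lborel (\<lambda>p. f p * (bump n a b (fst p - t) * bump n c d (snd p)))"
    proof (rule integrable_mult_compact_support[where K = "cbox (a + t, c) (b + t, d)" and C = 1])
      fix p :: "real \<times> real"
      show "\<bar>bump n a b (fst p - t) * bump n c d (snd p)\<bar> \<le> 1"
        using w01[of n "(fst p - t, snd p)"] by simp
      assume "p \<notin> cbox (a + t, c) (b + t, d)"
      then have "(fst p - t, snd p) \<notin> ?K" by (cases p) auto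
      from wK[OF this, of n] show "bump n a b (fst p - t) * bump n c d (snd p) = 0" by simp
    qed (auto intro!: fi compact_cbox)
    have t2: "(LINT p|lborel. f (p + (t, 0)) * ?w n p) =
        (LINT p|lborel. f p * (bump n a b (fst p - t) * bump n c d (snd p)))"
      and i3: "integrable lborel (\<lambda>p. f (p + (t, 0)) * ?w n p)"
      using lborel_integral_translate[of "\<lambda>p. f p * (bump n a b (fst p - t) * bump n c d (snd p))" "(t, 0)"] i2
      by simp_all
    have "(LINT p|lborel. (f p - f (p + (t, 0))) * ?w n p) =
        (LINT p|lborel. f p * ?w n p) - (LINT p|lborel. f (p + (t, 0)) * ?w n p)"
      using i1 i3 by (simp add: left_diff_distrib)
    also have "\<dots> = (LINT p|lborel. f p * ((bump n a b (fst p) - bump n a b (fst p - t)) * bump n c d (snd p)))"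
      unfolding t2 using i1 i2 by (simp add: left_diff_distrib right_diff_distrib)
    also have "\<bar>\<dots>\<bar> \<le> A * (t * (b - a) * (d - c))"
      by (rule weak_derivative_tested_difference[OF _ \<open>0 \<le> A\<close> A test])
         (use assms in \<open>auto intro!: smooth_bump bump_nonneg b1 bump_outside\<close>)
    finally show ?thesis .
  qed
  have "(\<lambda>n. LINT p|lborel. (f p - f (p + (t, 0))) * ?w n p) \<longlonglongrightarrow>
      (LINT p|lborel. indicator (box (a, c) (b, d)) p *\<^sub>R (f p - f (p + (t, 0))))"
  proof (rule integral_dominated_convergence)
    show "integrable lborel (\<lambda>p. \<bar>indicator ?K p *\<^sub>R f p\<bar> + \<bar>indicator ?K p *\<^sub>R f (p + (t, 0))\<bar>)"
      using fK fsK unfolding set_integrable_def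
      by (intro Bochner_Integration.integrable_add integrable_abs)
    show "AE p in lborel. (\<lambda>n. (f p - f (p + (t, 0))) * ?w n p) \<longlonglongrightarrow>
        indicator (box (a, c) (b, d)) p *\<^sub>R (f p - f (p + (t, 0)))"
    proof (rule AE_I2)
      fix p
      have "(\<lambda>n. (f p - f (p + (t, 0))) * ?w n p) \<longlonglongrightarrow>
         (f p - f (p + (t, 0))) * (indicator {a<..<b} (fst p) * indicator {c<..<d} (snd p))"
        by (intro tendsto_mult tendsto_const bump_tendsto_indicator)
      moreover have "(f p - f (p + (t, 0))) * (indicator {a<..<b} (fst p) * indicator {c<..<d} (snd p)) =
          indicator (box (a, c) (b, d)) p *\<^sub>R (f p - f (p + (t, 0)))"
        by (auto simp: indicator_def iff)
      ultimately show "(\<lambda>n. (f p - f (p + (t, 0))) * ?w n p) \<longlonglongrightarrow>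
        indicator (box (a, c) (b, d)) p *\<^sub>R (f p - f (p + (t, 0)))"
        by simp
    qed
    show "AE p in lborel. norm ((f p - f (p + (t, 0))) * ?w n p) \<le>
        \<bar>indicator ?K p *\<^sub>R f p\<bar> + \<bar>indicator ?K p *\<^sub>R f (p + (t, 0))\<bar>" for n
    proof (rule AE_I2)
      fix p
      show "norm ((f p - f (p + (t, 0))) * ?w n p) \<le>
        \<bar>indicator ?K p *\<^sub>R f p\<bar> + \<bar>indicator ?K p *\<^sub>R f (p + (t, 0))\<bar>"
      proof (cases "p \<in> ?K")
        case True
        have "norm ((f p - f (p + (t, 0))) * ?w n p) \<le> \<bar>f p - f (p + (t, 0))\<bar> * 1"
          unfolding real_norm_def abs_mult[of _ "?w n p"] by (intro mult_left_mono w01) simp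
        then show ?thesis using True by simp
      qed (simp add: wK)
    qed
  qed auto
  then show ?thesis unfolding set_lebesgue_integral_def
    by (intro LIMSEQ_le_const2[OF tendsto_rabs]) (auto intro: tested)
qed

text \<open>
  Both \<open>A t - (f(p) - f(p + (t,0)))\<close> and \<open>A t + (f(p) - f(p + (t,0)))\<close> have nonnegative integrals
  over boxes.
\<close>

lemma weak_derivative_translate_bound:
  fixes f g :: "real \<times> real \<Rightarrow> real"
  assumes [measurable]: "f \<in> borel_measurable borel" "g \<in> borel_measurable borel"
    and fi: "\<And>K. compact K \<Longrightarrow> set_integrable lborel K f"
    and "0 \<le> A" and A: "AE p in lborel. \<bar>g p\<bar> \<le> A"
    and test: "\<And>u u' v a b c d. \<lbrakk>smooth u; \<And>x. (u has_real_derivative u' x) (at x); smooth v;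
        \<And>x. x \<notin> {a..b} \<Longrightarrow> u x = 0; \<And>y. y \<notin> {c..d} \<Longrightarrow> v y = 0\<rbrakk> \<Longrightarrow>
        (LINT p|lborel. f p * (u' (fst p) * v (snd p))) =
        - (LINT p|lborel. g p * (u (fst p) * v (snd p)))"
    and "0 < t"
  shows "AE p in lborel. \<bar>f (p + (t, 0)) - f p\<bar> \<le> A * t"
proof -
  let ?D = "\<lambda>p. f p - f (p + (t, 0))"
  have Di: "set_integrable lborel (box p q) ?D" for p q
  proof -
    have "integrable lborel (\<lambda>r. f r * indicator (box p q) (r - (t, 0)))"
      by (rule integrable_mult_compact_support[where K = "cbox (p + (t, 0)) (q + (t, 0))" and C = 1])
         (auto intro!: fi compact_Times simp: indicator_def box_prod cbox_prod mem_Times_iff)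
    then have "integrable lborel (\<lambda>r. f (r + (t, 0)) * indicator (box p q) (r + (t, 0) - (t, 0)))"
      by (subst lborel_integral_translate(2)) auto
    then have "set_integrable lborel (box p q) (\<lambda>r. f (r + (t, 0)))"
      by (simp add: set_integrable_def mult.commute)
    moreover have "set_integrable lborel (box p q) f"
      using fi[OF compact_cbox[of p q]] by (rule set_integrable_subset) (use box_subset_cbox in auto)
    ultimately show ?thesis by (intro set_integral_diff(1))
  qed
  have ci: "set_integrable lborel (box p q) (\<lambda>_. A * t)" for p q :: "real \<times> real"
    unfolding set_integrable_def
    by (intro integrable_scaleR_left integrable_real_indicator) (use emeasure_lborel_box_finite[of p q] in auto)
  have "AE p in lborel. 0 \<le> A * t - s * ?D p" if s: "\<bar>s\<bar> = 1" for s
  proof (rule AE_nonneg_if_box_integrals_nonneg)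
    show "set_integrable lborel (box p q) (\<lambda>r. A * t - s * ?D r)" for p q
      by (intro set_integral_diff(1) ci set_integrable_mult_right Di)
    show "0 \<le> (LINT r:box p q|lborel. A * t - s * ?D r)" for p q
    proof (cases "fst p < fst q \<and> snd p < snd q")
      case False
      then have "box p q = {}" by (auto simp: box_prod)
      then show ?thesis by (simp add: set_lebesgue_integral_def)
    next
      case True
      obtain a c b d where pq: "p = (a, c)" "q = (b, d)" by (cases p, cases q)
      then have lt: "a < b" "c < d" using True by auto
      have "emeasure lborel (box p q) = ennreal ((b - a) * (d - c))"
        unfolding box_prod pq lborel_prod[symmetric]
        using lt by (simp add: lborel.emeasure_pair_measure_Times ennreal_mult)
      then have m: "measure lborel (box p q) = (b - a) * (d - c)"
        using lt by (simp add: measure_def)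
      have "s * (LINT r:box p q|lborel. ?D r) \<le> \<bar>s * (LINT r:box p q|lborel. ?D r)\<bar>" by (rule abs_ge_self)
      also have "\<dots> = \<bar>LINT r:box p q|lborel. ?D r\<bar>" by (simp only: abs_mult s mult_1)
      also have "\<dots> \<le> A * (t * (b - a) * (d - c))"
        unfolding pq by (rule weak_derivative_box_difference[OF assms(1,2) fi \<open>0 \<le> A\<close> A test lt \<open>0 < t\<close>])
      also have "\<dots> = (LINT r:box p q|lborel. A * t)"
        by (simp add: set_lebesgue_integral_def m)
      finally have "0 \<le> (LINT r:box p q|lborel. A * t) - s * (LINT r:box p q|lborel. ?D r)" by simp
      also have "\<dots> = (LINT r:box p q|lborel. A * t) - (LINT r:box p q|lborel. s * ?D r)"
        by (simp only: set_integral_mult_right)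
      also have "\<dots> = (LINT r:box p q|lborel. A * t - s * ?D r)"
        by (rule set_integral_diff(2)[symmetric, OF ci set_integrable_mult_right[OF Di]])
      finally show ?thesis .
    qed
  qed measurable
  from this[of 1] this[of "- 1"]
  have "AE p in lborel. 0 \<le> A * t - 1 * ?D p" "AE p in lborel. 0 \<le> A * t - (- 1) * ?D p"
    by simp_all
  then show ?thesis by eventually_elim (simp add: abs_le_iff)
qed

section \<open>Pointwise oscillation on a square\<close>

text \<open>
  The essential supremum is finite and nonnegative, so converting it to a real number loses
  nothing; nonnegativity uses that the measure is not zero.
\<close>

lemma Linf_norm_AE_bound:
  assumes "g \<in> Linf"
  shows "AE p in lebesgue. \<bar>g p\<bar> \<le> Linf_norm g" and "0 \<le> Linf_norm g"
proof -
  let ?s = "esssup lebesgue (\<lambda>p. ereal \<bar>g p\<bar>)"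
  have fin: "?s < \<infinity>" using assms by (simp add: Linf_def)
  have AE: "AE p in lebesgue. ereal \<bar>g p\<bar> \<le> ?s" by (rule esssup_AE)
  have "\<exists>p. ereal \<bar>g p\<bar> \<le> ?s"
  proof (rule ccontr)
    assume "\<nexists>p. ereal \<bar>g p\<bar> \<le> ?s"
    with AE have "AE p in (lebesgue :: (real \<times> real) measure). False"
      by (auto elim: eventually_mono)
    then have "AE p in (lborel :: (real \<times> real) measure). False" unfolding AE_completion_iff .
    then show False by (simp add: trivial_limit_def[symmetric] ae_filter_eq_bot_iff)
  qed
  then have nn: "0 \<le> ?s" by (metis abs_ge_zero ereal_less_eq(5) order_trans)
  then show "0 \<le> Linf_norm g" by (simp add: Linf_norm_def real_of_ereal_pos)
  have "ereal (Linf_norm g) = ?s"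
    unfolding Linf_norm_def using nn fin by (intro ereal_real') auto
  then show "AE p in lebesgue. \<bar>g p\<bar> \<le> Linf_norm g"
    using AE by (metis (mono_tags, lifting) ereal_less_eq(3) eventually_mono)
qed

text \<open>
  Passage to Borel representatives: translation, swapping of coordinates and Fubini's theorem are
  applied to \<open>lborel\<close>, while weak derivatives and norms refer to its completion.
\<close>

lemma integral_lebesgue_eq_lborel_representative:
  fixes f f' w :: "real \<times> real \<Rightarrow> real"
  assumes f [measurable]: "f \<in> borel_measurable lebesgue"
    and b [measurable]: "f' \<in> borel_measurable borel" "w \<in> borel_measurable borel"
    and AE: "AE p in lborel. f p = f' p"
  shows "(LINT p|lebesgue. f p * w p) = (LINT p|lborel. f' p * w p)"
    and "integrable lebesgue (\<lambda>p. f p * w p) \<longleftrightarrow> integrable lborel (\<lambda>p. f' p * w p)"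
proof -
  have [measurable]: "f' \<in> borel_measurable lebesgue" "w \<in> borel_measurable lebesgue"
    using b by (auto intro: measurable_completion)
  have AE': "AE p in lebesgue. f p * w p = f' p * w p"
    using AE unfolding AE_completion_iff by eventually_elim simp
  have "(LINT p|lebesgue. f p * w p) = (LINT p|lebesgue. f' p * w p)"
    using AE' by (intro integral_cong_AE) auto
  then show "(LINT p|lebesgue. f p * w p) = (LINT p|lborel. f' p * w p)"
    by (simp add: integral_completion)
  have "integrable lebesgue (\<lambda>p. f p * w p) \<longleftrightarrow> integrable lebesgue (\<lambda>p. f' p * w p)"
    using AE' by (intro integrable_cong_AE) auto
  then show "integrable lebesgue (\<lambda>p. f p * w p) \<longleftrightarrow> integrable lborel (\<lambda>p. f' p * w p)"
    by (simp add: integrable_completion)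
qed

lemma locally_integrable_representative:
  fixes f f' :: "real \<times> real \<Rightarrow> real"
  assumes "locally_integrable f" "f \<in> borel_measurable lebesgue" "f' \<in> borel_measurable borel"
    "AE p in lborel. f p = f' p" "compact K"
  shows "set_integrable lborel K f'"
proof -
  have K: "indicator K \<in> borel_measurable borel"
    using \<open>compact K\<close> by (intro borel_measurable_indicator borel_closed compact_imp_closed)
  show ?thesis
    using integral_lebesgue_eq_lborel_representative(2)[OF assms(2,3) K assms(4)] assms(1,5)
    unfolding locally_integrable_def set_integrable_def by (simp add: mult.commute)
qed

lemma smooth_derivative_continuous:
  assumes "smooth u" "\<And>x. (u has_real_derivative u' x) (at x)"
  shows "continuous_on UNIV u'"
proof -
  have "smooth_upto (Suc 0) u" using assms(1) unfolding smooth_def by blast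
  then obtain w where w: "\<And>x. (u has_real_derivative w x) (at x)" "continuous_on UNIV w" by auto
  have "u' = w" using DERIV_unique[OF assms(2) w(1)] by auto
  then show ?thesis using w(2) by simp
qed

lemma lborel_distr_swap:
  "distr lborel borel prod.swap = (lborel :: (real \<times> real) measure)"
proof -
  have "(lborel :: (real \<times> real) measure) = distr lborel lborel (\<lambda>(x, y). (y, x))"
    using lborel_pair.distr_pair_swap[where 'a = real and 'b = real] unfolding lborel_prod .
  also have "\<dots> = distr lborel borel prod.swap" by (rule distr_cong) auto
  finally show ?thesis by simp
qed

lemma borel_measurable_swap [measurable]:
  "(prod.swap :: real \<times> real \<Rightarrow> real \<times> real) \<in> borel_measurable borel"
  by (intro borel_measurable_continuous_onI continuous_on_swap)

lemma lborel_integral_swap: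
  fixes f :: "real \<times> real \<Rightarrow> real"
  assumes [measurable]: "f \<in> borel_measurable borel"
  shows "(LINT p|lborel. f (prod.swap p)) = (LINT p|lborel. f p)"
    and "integrable lborel (\<lambda>p. f (prod.swap p)) \<longleftrightarrow> integrable lborel f"
proof -
  have "(LINT p|lborel. f p) = (LINT p|distr lborel borel prod.swap. f p)"
    by (simp add: lborel_distr_swap)
  also have "\<dots> = (LINT p|lborel. f (prod.swap p))" by (rule integral_distr) auto
  finally show "(LINT p|lborel. f (prod.swap p)) = (LINT p|lborel. f p)" by simp
  have "integrable lborel f \<longleftrightarrow> integrable (distr lborel borel prod.swap) f"
    by (simp add: lborel_distr_swap)
  also have "\<dots> \<longleftrightarrow> integrable lborel (\<lambda>p. f (prod.swap p))" by (rule integrable_distr_eq) auto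
  finally show "integrable lborel (\<lambda>p. f (prod.swap p)) \<longleftrightarrow> integrable lborel f" by simp
qed

lemma AE_lborel_swap:
  assumes "AE p in lborel. P (p :: real \<times> real)"
  shows "AE p in lborel. P (prod.swap p)"
proof -
  have "AE p in distr lborel borel prod.swap. P p" using assms unfolding lborel_distr_swap .
  then show ?thesis by (rule AE_distrD[rotated]) simp
qed

lemma weak_partial_x_translate_bound:
  assumes wx: "has_weak_partial_x f g" and gL: "g \<in> Linf" and fm: "f \<in> borel_measurable lebesgue"
    and f'm: "f' \<in> borel_measurable borel" and ff': "AE p in lborel. f p = f' p" and "0 < t"
  shows "AE p in lborel. \<bar>f' (p + (t, 0)) - f' p\<bar> \<le> Linf_norm g * t"
proof -
  have gm: "g \<in> borel_measurable lebesgue" using gL by (simp add: Linf_def)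
  obtain g' where g'm: "g' \<in> borel_measurable borel" and gg': "AE p in lborel. g p = g' p"
    using completion_ex_borel_measurable_real[OF gm] by auto
  have bound: "AE p in lborel. \<bar>g' p\<bar> \<le> Linf_norm g"
    using gg' Linf_norm_AE_bound(1)[OF gL] unfolding AE_completion_iff by eventually_elim simp
  show ?thesis
  proof (rule weak_derivative_translate_bound[OF f'm g'm _ Linf_norm_AE_bound(2)[OF gL] bound _ \<open>0 < t\<close>])
    show "set_integrable lborel K f'" if "compact K" for K
      using wx that unfolding has_weak_partial_x_def
      by (intro locally_integrable_representative[OF _ fm f'm ff']) auto
    fix u u' v :: "real \<Rightarrow> real" and a b c d
    assume u: "smooth u" "\<And>x. (u has_real_derivative u' x) (at x)" and v: "smooth v"
      and s: "\<And>x. x \<notin> {a..b} \<Longrightarrow> u x = 0" "\<And>y. y \<notin> {c..d} \<Longrightarrow> v y = 0"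
    have [measurable]: "u \<in> borel_measurable borel" "u' \<in> borel_measurable borel" "v \<in> borel_measurable borel"
      using u v smooth_derivative_continuous[OF u] smooth_imp_continuous
      by (auto intro: borel_measurable_continuous_onI)
    let ?\<phi> = "\<lambda>p. u (fst p) * v (snd p)"
    have px: "partial_x ?\<phi> = (\<lambda>p. u' (fst p) * v (snd p))"
      unfolding partial_x_def by (auto simp: DERIV_imp_deriv[OF DERIV_cmult_right[OF u(2)]])
    have "?\<phi> \<in> Cc_infinity" by (rule product_in_Cc_infinity[OF u(1) v s])
    then have "(LINT p|lebesgue. f p * partial_x ?\<phi> p) = - (LINT p|lebesgue. g p * ?\<phi> p)"
      using wx unfolding has_weak_partial_x_def by blast
    then show "(LINT p|lborel. f' p * (u' (fst p) * v (snd p))) = - (LINT p|lborel. g' p * (u (fst p) * v (snd p)))"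
      by (simp add: px integral_lebesgue_eq_lborel_representative(1)[OF fm f'm _ ff']
           integral_lebesgue_eq_lborel_representative(1)[OF gm g'm _ gg'])
  qed
qed

text \<open>
  Swapping the coordinates reduces this to the estimate in the first direction.
\<close>

lemma weak_partial_y_translate_bound:
  assumes wy: "has_weak_partial_y f g" and gL: "g \<in> Linf" and fm: "f \<in> borel_measurable lebesgue"
    and f'm: "f' \<in> borel_measurable borel" and ff': "AE p in lborel. f p = f' p" and "0 < t"
  shows "AE p in lborel. \<bar>f' (p + (0, t)) - f' p\<bar> \<le> Linf_norm g * t"
proof -
  note [measurable] = f'm
  have gm: "g \<in> borel_measurable lebesgue" using gL by (simp add: Linf_def)
  obtain g' where g'm [measurable]: "g' \<in> borel_measurable borel" and gg': "AE p in lborel. g p = g' p"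
    using completion_ex_borel_measurable_real[OF gm] by auto
  have "AE p in lborel. \<bar>g' p\<bar> \<le> Linf_norm g"
    using gg' Linf_norm_AE_bound(1)[OF gL] unfolding AE_completion_iff by eventually_elim simp
  then have bound: "AE p in lborel. \<bar>g' (prod.swap p)\<bar> \<le> Linf_norm g" by (rule AE_lborel_swap)
  have "AE p in lborel. \<bar>f' (prod.swap (p + (t, 0))) - f' (prod.swap p)\<bar> \<le> Linf_norm g * t"
  proof (rule weak_derivative_translate_bound[OF _ _ _ Linf_norm_AE_bound(2)[OF gL] bound _ \<open>0 < t\<close>])
    show "set_integrable lborel K (\<lambda>p. f' (prod.swap p))" if "compact K" for K
    proof -
      have K: "compact (prod.swap ` K)"
        using that by (intro compact_continuous_image continuous_on_swap)
      have [measurable]: "prod.swap ` K \<in> sets borel"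
        using K by (intro borel_closed compact_imp_closed)
      have "set_integrable lborel (prod.swap ` K) f'"
        using wy K unfolding has_weak_partial_y_def
        by (intro locally_integrable_representative[OF _ fm f'm ff']) auto
      then have "integrable lborel (\<lambda>p. indicator (prod.swap ` K) (prod.swap p) *\<^sub>R f' (prod.swap p))"
        unfolding set_integrable_def by (subst lborel_integral_swap(2)) auto
      moreover have "indicator (prod.swap ` K) (prod.swap p) = (indicator K p :: real)" for p
        by (cases p) (simp add: indicator_def)
      ultimately show ?thesis by (simp add: set_integrable_def)
    qed
    fix u u' v :: "real \<Rightarrow> real" and a b c d
    assume u: "smooth u" "\<And>x. (u has_real_derivative u' x) (at x)" and v: "smooth v"
      and s: "\<And>x. x \<notin> {a..b} \<Longrightarrow> u x = 0" "\<And>y. y \<notin> {c..d} \<Longrightarrow> v y = 0"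
    have [measurable]: "u \<in> borel_measurable borel" "u' \<in> borel_measurable borel" "v \<in> borel_measurable borel"
      using u v smooth_derivative_continuous[OF u] smooth_imp_continuous
      by (auto intro: borel_measurable_continuous_onI)
    let ?\<phi> = "\<lambda>p. v (fst p) * u (snd p)"
    have py: "partial_y ?\<phi> = (\<lambda>p. v (fst p) * u' (snd p))"
      unfolding partial_y_def by (auto simp: DERIV_imp_deriv[OF DERIV_cmult[OF u(2)]])
    have "?\<phi> \<in> Cc_infinity" by (rule product_in_Cc_infinity[OF v u(1) s(2,1)])
    then have "(LINT p|lebesgue. f p * partial_y ?\<phi> p) = - (LINT p|lebesgue. g p * ?\<phi> p)"
      using wy unfolding has_weak_partial_y_def by blast
    then have "(LINT p|lborel. f' p * (v (fst p) * u' (snd p))) = - (LINT p|lborel. g' p * ?\<phi> p)"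
      by (simp add: py integral_lebesgue_eq_lborel_representative(1)[OF fm f'm _ ff']
           integral_lebesgue_eq_lborel_representative(1)[OF gm g'm _ gg'])
    moreover have "(LINT p|lborel. f' (prod.swap p) * (u' (fst p) * v (snd p))) =
         (LINT p|lborel. f' p * (v (fst p) * u' (snd p)))"
      using lborel_integral_swap(1)[of "\<lambda>p. f' p * (v (fst p) * u' (snd p))"] by (simp add: mult.commute)
    moreover have "(LINT p|lborel. g' (prod.swap p) * (u (fst p) * v (snd p))) =
         (LINT p|lborel. g' p * (v (fst p) * u (snd p)))"
      using lborel_integral_swap(1)[of "\<lambda>p. g' p * (v (fst p) * u (snd p))"] by (simp add: mult.commute)
    ultimately show "(LINT p|lborel. f' (prod.swap p) * (u' (fst p) * v (snd p))) =
        - (LINT p|lborel. g' (prod.swap p) * (u (fst p) * v (snd p)))" by simp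
  qed auto
  from AE_lborel_swap[OF this] show ?thesis
  proof eventually_elim
    case (elim p)
    have "prod.swap (prod.swap p + (t, 0)) = p + (0, t)" by (cases p) simp
    then show ?case using elim by simp
  qed
qed

lemma translate_bound_all_directions:
  fixes f :: "real \<times> real \<Rightarrow> real"
  assumes x: "\<And>t. 0 < t \<Longrightarrow> AE p in lborel. \<bar>f (p + (t, 0)) - f p\<bar> \<le> A * t"
    and y: "\<And>t. 0 < t \<Longrightarrow> AE p in lborel. \<bar>f (p + (0, t)) - f p\<bar> \<le> B * t"
  shows "AE p in lborel. \<bar>f (p + s) - f p\<bar> \<le> A * \<bar>fst s\<bar> + B * \<bar>snd s\<bar>"
proof -
  have both_signs: "AE p in lborel. \<bar>f (p + t *\<^sub>R e) - f p\<bar> \<le> C * \<bar>t\<bar>"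
    if pos: "\<And>t. 0 < t \<Longrightarrow> AE p in lborel. \<bar>f (p + t *\<^sub>R e) - f p\<bar> \<le> C * t" for t C e
  proof (cases t "0::real" rule: linorder_cases)
    case less
    have "AE p in lborel. \<bar>f (p + t *\<^sub>R e + (- t) *\<^sub>R e) - f (p + t *\<^sub>R e)\<bar> \<le> C * - t"
      using less by (intro AE_lborel_translate[OF pos]) simp
    then show ?thesis using less by (simp add: add.assoc abs_minus_commute flip: scaleR_left.add)
  next
    case greater
    then show ?thesis using pos by simp
  qed simp
  obtain a b where s: "s = (a, b)" by (cases s)
  have X: "AE p in lborel. \<bar>f (p + (a, 0)) - f p\<bar> \<le> A * \<bar>a\<bar>"
    using both_signs[of "(1, 0)" A a] x by simp
  have Y: "AE p in lborel. \<bar>f (p + (0, b)) - f p\<bar> \<le> B * \<bar>b\<bar>"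
    using both_signs[of "(0, 1)" B b] y by simp
  from X AE_lborel_translate[OF Y, of "(a, 0)"] show ?thesis
  proof eventually_elim
    case (elim p)
    have e: "p + (a, 0) + (0, b) = p + s" by (cases p) (simp add: s)
    have "\<bar>f (p + s) - f (p + (a, 0))\<bar> \<le> B * \<bar>b\<bar>" using elim(2) unfolding e .
    with elim(1) have "\<bar>f (p + s) - f p\<bar> \<le> A * \<bar>a\<bar> + B * \<bar>b\<bar>" by linarith
    then show ?case by (simp add: s)
  qed
qed

text \<open>
  The exceptional null set in the hypothesis depends on the shift \<open>s\<close>. Fubini's theorem exchanges
  the two quantifiers, and for fixed \<open>p\<close> the shift is replaced by the second point \<open>q = p + s\<close>.
\<close>

lemma AE_pairs_from_translates:
  fixes f :: "real \<times> real \<Rightarrow> real"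
  assumes [measurable]: "f \<in> borel_measurable borel"
    and tr: "\<And>s. AE p in lborel. \<bar>f (p + s) - f p\<bar> \<le> A * \<bar>fst s\<bar> + B * \<bar>snd s\<bar>"
  shows "AE p in lborel. AE q in lborel. \<bar>f q - f p\<bar> \<le> A * \<bar>fst q - fst p\<bar> + B * \<bar>snd q - snd p\<bar>"
proof -
  have "AE p in lborel. AE s in lborel. \<bar>f (p + s) - f p\<bar> \<le> A * \<bar>fst s\<bar> + B * \<bar>snd s\<bar>"
  proof (subst lborel_pair.AE_commute)
    show "{x \<in> space (lborel \<Otimes>\<^sub>M lborel). \<bar>f (fst x + snd x) - f (fst x)\<bar>
        \<le> A * \<bar>fst (snd x)\<bar> + B * \<bar>snd (snd x)\<bar>} \<in> sets (lborel \<Otimes>\<^sub>M lborel)"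
      by measurable
  qed (use tr in simp)
  then show ?thesis
  proof eventually_elim
    case (elim p)
    from AE_lborel_translate[OF elim, of "- p"] show ?case by simp
  qed
qed

text \<open>
  For almost every \<open>p\<close> the Lipschitz estimate holds for almost all \<open>q\<close>; integrating it over
  \<open>q \<in> Q\<close> compares \<open>f(p)\<close> with the average.
\<close>

lemma cell_average_deviation:
  fixes f fx fy :: "real \<times> real \<Rightarrow> real" and a c h :: real
  assumes fm: "f \<in> borel_measurable lebesgue"
    and wx: "has_weak_partial_x f fx" "fx \<in> Linf" and wy: "has_weak_partial_y f fy" "fy \<in> Linf"
    and "0 < h"
  defines "Q \<equiv> {a..a+h} \<times> {c..c+h}"
  shows "AE p in lebesgue. p \<in> Q \<longrightarrow>
    \<bar>f p - (LINT q:Q|lebesgue. f q) / h\<^sup>2\<bar> \<le> h * (Linf_norm fx + Linf_norm fy)"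
proof -
  obtain f' where f'm [measurable]: "f' \<in> borel_measurable borel" and ff': "AE p in lborel. f p = f' p"
    using completion_ex_borel_measurable_real[OF fm] by auto
  let ?A = "Linf_norm fx" and ?B = "Linf_norm fy"
  have AB: "0 \<le> ?A" "0 \<le> ?B" using Linf_norm_AE_bound(2) wx(2) wy(2) by auto
  have Qc: "compact Q" unfolding Q_def by (intro compact_Times compact_Icc)
  have Qb [measurable]: "Q \<in> sets borel" using Qc by (intro borel_closed compact_imp_closed)
  have mQ: "emeasure lborel Q = ennreal (h\<^sup>2)"
    unfolding Q_def lborel_prod[symmetric] using \<open>0 < h\<close>
    by (simp add: lborel.emeasure_pair_measure_Times ennreal_mult[symmetric] power2_eq_square)
  then have mQ': "measure lborel Q = h\<^sup>2" by (simp add: measure_def)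
  have i: "set_integrable lborel Q f'"
    using wx Qc unfolding has_weak_partial_x_def
    by (intro locally_integrable_representative[OF _ fm f'm ff']) auto
  have ic: "set_integrable lborel Q (\<lambda>_. C)" for C :: real
    unfolding set_integrable_def
    by (intro integrable_scaleR_left integrable_real_indicator) (auto simp: mQ)
  have intQ: "(LINT q:Q|lborel. C) = C * h\<^sup>2" for C
    by (simp add: set_lebesgue_integral_def mQ')
  have same: "(LINT q:Q|lebesgue. f q) = (LINT q:Q|lborel. f' q)"
    unfolding set_lebesgue_integral_def
    using integral_lebesgue_eq_lborel_representative(1)[OF fm f'm _ ff', of "indicator Q"]
    by (simp add: mult.commute)
  have "AE p in lborel. AE q in lborel. \<bar>f' q - f' p\<bar> \<le> ?A * \<bar>fst q - fst p\<bar> + ?B * \<bar>snd q - snd p\<bar>"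
    by (intro AE_pairs_from_translates translate_bound_all_directions f'm
         weak_partial_x_translate_bound[OF wx fm f'm ff'] weak_partial_y_translate_bound[OF wy fm f'm ff'])
  then have "AE p in lborel. p \<in> Q \<longrightarrow> \<bar>f p - (LINT q:Q|lebesgue. f q) / h\<^sup>2\<bar> \<le> h * (?A + ?B)"
    using ff'
  proof eventually_elim
    case (elim p)
    show ?case
    proof
      assume p: "p \<in> Q"
      have "f' p * h\<^sup>2 - (LINT q:Q|lborel. f' q) = (LINT q:Q|lborel. f' p - f' q)"
        by (subst set_integral_diff(2)[OF ic i]) (simp add: intQ)
      also have "\<bar>\<dots>\<bar> \<le> (LINT q:Q|lborel. h * (?A + ?B))"
        unfolding set_lebesgue_integral_def
      proof (intro integral_abs_bound[THEN order_trans] integral_mono_AE)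
        show "integrable lborel (\<lambda>q. indicator Q q *\<^sub>R (h * (?A + ?B)))"
          using ic unfolding set_integrable_def .
        show "integrable lborel (\<lambda>q. \<bar>indicator Q q *\<^sub>R (f' p - f' q)\<bar>)"
          using set_integral_diff(1)[OF ic i] unfolding set_integrable_def by (rule integrable_abs)
        show "AE q in lborel. \<bar>indicator Q q *\<^sub>R (f' p - f' q)\<bar> \<le> indicator Q q *\<^sub>R (h * (?A + ?B))"
          using elim(1)
        proof eventually_elim
          case (elim q)
          show ?case
          proof (cases "q \<in> Q")
            case True
            have "\<bar>fst q - fst p\<bar> \<le> h" "\<bar>snd q - snd p\<bar> \<le> h"
              using True p by (auto simp: Q_def abs_le_iff)
            then have "?A * \<bar>fst q - fst p\<bar> + ?B * \<bar>snd q - snd p\<bar> \<le> ?A * h + ?B * h"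
              using AB by (intro add_mono mult_left_mono) auto
            then show ?thesis using elim True by (simp add: algebra_simps abs_minus_commute)
          qed simp
        qed
      qed
      also have "\<dots> = h * (?A + ?B) * h\<^sup>2" by (simp add: intQ)
      finally have "\<bar>f' p * h\<^sup>2 - (LINT q:Q|lborel. f' q)\<bar> / h\<^sup>2 \<le> h * (?A + ?B)"
        using \<open>0 < h\<close> by (simp add: divide_le_eq)
      also have "\<bar>f' p * h\<^sup>2 - (LINT q:Q|lborel. f' q)\<bar> / h\<^sup>2 = \<bar>(f' p * h\<^sup>2 - (LINT q:Q|lborel. f' q)) / h\<^sup>2\<bar>"
        by (simp add: abs_divide)
      also have "(f' p * h\<^sup>2 - (LINT q:Q|lborel. f' q)) / h\<^sup>2 = f' p - (LINT q:Q|lborel. f' q) / h\<^sup>2"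
        using \<open>0 < h\<close> by (simp add: diff_divide_distrib)
      finally show "\<bar>f p - (LINT q:Q|lebesgue. f q) / h\<^sup>2\<bar> \<le> h * (?A + ?B)"
        unfolding same using elim(2) by simp
    qed
  qed
  then show ?thesis unfolding AE_completion_iff .
qed

section \<open>Test functions: sup norms and Lipschitz bound\<close>

text \<open>
  A nonempty open set is not negligible, so for continuous functions the essential bound holds at
  every point.
\<close>

lemma continuous_bound_Linf_norm:
  assumes cont: "continuous_on UNIV w" and bound: "\<And>p. \<bar>w p\<bar> \<le> C"
  shows "\<bar>w p\<bar> \<le> Linf_norm w" "0 \<le> Linf_norm w"
proof -
  have [measurable]: "w \<in> borel_measurable lebesgue"
    using borel_measurable_continuous_onI[OF cont] by (auto intro: measurable_completion)
  have "esssup lebesgue (\<lambda>p. ereal \<bar>w p\<bar>) \<le> ereal C"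
    by (intro esssup_I) (use bound in auto)
  then have L: "w \<in> Linf" by (auto simp: Linf_def)
  show "0 \<le> Linf_norm w" by (rule Linf_norm_AE_bound(2)[OF L])
  let ?U = "{q. Linf_norm w < \<bar>w q\<bar>}"
  have "open ?U" by (intro open_Collect_less continuous_intros cont)
  moreover have "negligible ?U"
  proof -
    have "AE q in lebesgue. q \<notin> ?U" using Linf_norm_AE_bound(1)[OF L] by eventually_elim auto
    then have "?U \<in> null_sets lebesgue"
      using \<open>open ?U\<close> by (simp add: AE_iff_null_sets)
    then show ?thesis by (simp add: negligible_iff_null_sets)
  qed
  ultimately have "?U = {}" using open_not_negligible by blast
  then show "\<bar>w p\<bar> \<le> Linf_norm w" by (cases p) (auto simp: not_less)
qed

lemma Cc_infinity_continuous:
  assumes "\<phi> \<in> Cc_infinity"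
  shows "continuous_on UNIV \<phi>" "continuous_on UNIV (partial_x \<phi>)" "continuous_on UNIV (partial_y \<phi>)"
proof -
  have "C_k 0 \<phi>" "C_k (Suc 0) \<phi>" using assms unfolding Cc_infinity_def by blast+
  then show "continuous_on UNIV \<phi>" "continuous_on UNIV (partial_x \<phi>)" "continuous_on UNIV (partial_y \<phi>)"
    by auto
qed

lemma Cc_infinity_measurable: "\<phi> \<in> Cc_infinity \<Longrightarrow> \<phi> \<in> borel_measurable lebesgue"
  using borel_measurable_continuous_onI[OF Cc_infinity_continuous(1)] by (auto intro: measurable_completion)

lemma Cc_infinity_has_partial_derivatives:
  assumes "\<phi> \<in> Cc_infinity"
  shows "((\<lambda>t. \<phi> (t, y)) has_real_derivative partial_x \<phi> (x, y)) (at x)"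
    and "((\<lambda>t. \<phi> (x, t)) has_real_derivative partial_y \<phi> (x, y)) (at y)"
proof -
  have "C_k (Suc 0) \<phi>" using assms unfolding Cc_infinity_def by blast
  then show "((\<lambda>t. \<phi> (t, y)) has_real_derivative partial_x \<phi> (x, y)) (at x)"
      "((\<lambda>t. \<phi> (x, t)) has_real_derivative partial_y \<phi> (x, y)) (at y)"
    by (auto simp: partial_x_def partial_y_def DERIV_deriv_iff_real_differentiable)
qed

lemma Cc_infinity_bounds:
  assumes \<phi>: "\<phi> \<in> Cc_infinity"
  shows "\<bar>\<phi> p\<bar> \<le> Linf_norm \<phi>" "\<bar>partial_x \<phi> p\<bar> \<le> Linf_norm (partial_x \<phi>)"
    "\<bar>partial_y \<phi> p\<bar> \<le> Linf_norm (partial_y \<phi>)"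
    "0 \<le> Linf_norm \<phi>" "0 \<le> Linf_norm (partial_x \<phi>)" "0 \<le> Linf_norm (partial_y \<phi>)"
proof -
  define K where "K = closure {p. \<phi> p \<noteq> 0}"
  have K: "compact K" using \<phi> by (simp add: K_def Cc_infinity_def)
  have op: "open (- K)" by (simp add: K_def open_Compl)
  have out: "\<phi> q = 0" if "q \<in> - K" for q
    using that closure_subset[of "{p. \<phi> p \<noteq> 0}"] by (auto simp: K_def)
  have outx: "partial_x \<phi> (x, y) = 0" if "(x, y) \<in> - K" for x y
  proof -
    have "open ((\<lambda>t. (t, y)) -` (- K))" by (intro open_vimage op continuous_intros)
    then have "((\<lambda>t. \<phi> (t, y)) has_real_derivative 0) (at x)"
      by (rule has_field_derivative_transform_within_open[OF DERIV_const]) (use that in \<open>simp_all add: out\<close>)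
    with Cc_infinity_has_partial_derivatives(1)[OF \<phi>] show ?thesis by (rule DERIV_unique)
  qed
  have outy: "partial_y \<phi> (x, y) = 0" if "(x, y) \<in> - K" for x y
  proof -
    have "open ((\<lambda>t. (x, t)) -` (- K))" by (intro open_vimage op continuous_intros)
    then have "((\<lambda>t. \<phi> (x, t)) has_real_derivative 0) (at y)"
      by (rule has_field_derivative_transform_within_open[OF DERIV_const]) (use that in \<open>simp_all add: out\<close>)
    with Cc_infinity_has_partial_derivatives(2)[OF \<phi>] show ?thesis by (rule DERIV_unique)
  qed
  have bdd: "\<exists>C. \<forall>p. \<bar>w p\<bar> \<le> C"
    if "continuous_on UNIV w" "\<And>p. p \<in> - K \<Longrightarrow> w p = 0" for w :: "real \<times> real \<Rightarrow> real"
  proof -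
    have "compact (w ` K)" by (intro compact_continuous_image K continuous_on_subset[OF that(1)]) simp
    then have "bounded (w ` K)" by (rule compact_imp_bounded)
    then obtain C where "\<And>p. p \<in> K \<Longrightarrow> \<bar>w p\<bar> \<le> C"
      unfolding bounded_iff real_norm_def by blast
    then have "\<bar>w p\<bar> \<le> max C 0" for p using that(2)[of p] \<open>\<And>p. p \<in> K \<Longrightarrow> \<bar>w p\<bar> \<le> C\<close>[of p] by (cases "p \<in> K") (simp_all add: le_max_iff_disj)
    then show ?thesis by blast
  qed
  note cont = Cc_infinity_continuous[OF \<phi>]
  obtain C0 where C0: "\<And>p. \<bar>\<phi> p\<bar> \<le> C0" using bdd[OF cont(1) out] by blast
  have "partial_x \<phi> p = 0" if "p \<in> - K" for p using outx[of "fst p" "snd p"] that by simp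
  from bdd[OF cont(2) this] obtain C1 where C1: "\<And>p. \<bar>partial_x \<phi> p\<bar> \<le> C1" by blast
  have "partial_y \<phi> p = 0" if "p \<in> - K" for p using outy[of "fst p" "snd p"] that by simp
  from bdd[OF cont(3) this] obtain C2 where C2: "\<And>p. \<bar>partial_y \<phi> p\<bar> \<le> C2" by blast
  show "\<bar>\<phi> p\<bar> \<le> Linf_norm \<phi>" "\<bar>partial_x \<phi> p\<bar> \<le> Linf_norm (partial_x \<phi>)"
    "\<bar>partial_y \<phi> p\<bar> \<le> Linf_norm (partial_y \<phi>)"
    "0 \<le> Linf_norm \<phi>" "0 \<le> Linf_norm (partial_x \<phi>)" "0 \<le> Linf_norm (partial_y \<phi>)"
    by (fact continuous_bound_Linf_norm[OF cont(1) C0] continuous_bound_Linf_norm[OF cont(2) C1]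
        continuous_bound_Linf_norm[OF cont(3) C2])+
qed

lemma Cc_infinity_Lipschitz:
  assumes \<phi>: "\<phi> \<in> Cc_infinity"
  shows "\<bar>\<phi> p - \<phi> q\<bar> \<le> Linf_norm (partial_x \<phi>) * \<bar>fst p - fst q\<bar> + Linf_norm (partial_y \<phi>) * \<bar>snd p - snd q\<bar>"
proof -
  obtain a b c d where pq: "p = (a, b)" "q = (c, d)" by (cases p, cases q)
  have "norm (\<phi> (a, b) - \<phi> (c, b)) \<le> Linf_norm (partial_x \<phi>) * norm (a - c)"
    by (rule field_differentiable_bound[of UNIV "\<lambda>t. \<phi> (t, b)" "\<lambda>t. partial_x \<phi> (t, b)"])
       (simp_all add: Cc_infinity_bounds(2)[OF \<phi>] Cc_infinity_has_partial_derivatives(1)[OF \<phi>])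
  moreover have "norm (\<phi> (c, b) - \<phi> (c, d)) \<le> Linf_norm (partial_y \<phi>) * norm (b - d)"
    by (rule field_differentiable_bound[of UNIV "\<lambda>t. \<phi> (c, t)" "\<lambda>t. partial_y \<phi> (c, t)"])
       (simp_all add: Cc_infinity_bounds(3)[OF \<phi>] Cc_infinity_has_partial_derivatives(2)[OF \<phi>])
  ultimately show ?thesis unfolding pq by simp
qed

section \<open>Estimates on a single set of finite measure\<close>

lemma integrable_mult_AE_bounded:
  fixes f w :: "'a \<Rightarrow> real"
  assumes f: "integrable M f" and [measurable]: "w \<in> borel_measurable M" and w: "AE p in M. \<bar>w p\<bar> \<le> C"
  shows "integrable M (\<lambda>p. f p * w p)"
proof (rule Bochner_Integration.integrable_bound)
  show "integrable M (\<lambda>p. C * f p)" using f by (rule integrable_mult_right)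
  show "AE p in M. norm (f p * w p) \<le> norm (C * f p)"
    using w
  proof eventually_elim
    case (elim p)
    have "\<bar>f p\<bar> * \<bar>w p\<bar> \<le> \<bar>f p\<bar> * \<bar>C\<bar>" using elim by (intro mult_left_mono) linarith+
    then show ?case by (simp add: abs_mult mult.commute)
  qed
  show "(\<lambda>p. f p * w p) \<in> borel_measurable M" using f by measurable
qed

text \<open>
  Since \<open>a - f\<close> has integral zero over \<open>Q\<close>, replacing \<open>\<phi>\<close> by \<open>\<phi> - c\<close> does not change the integral.
  This cancellation gives the second power of the mesh size.
\<close>

lemma covariance_bound:
  fixes f \<phi> :: "'a \<Rightarrow> real"
  assumes Q [measurable]: "Q \<in> sets M" and m: "emeasure M Q = ennreal m" "0 < m"
    and f: "set_integrable M Q f" and a: "a = (LINT p:Q|M. f p) / m"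
    and \<phi> [measurable]: "\<phi> \<in> borel_measurable M"
    and d: "AE p in M. p \<in> Q \<longrightarrow> \<bar>f p - a\<bar> \<le> d" "0 \<le> d"
    and e: "\<And>p. p \<in> Q \<Longrightarrow> \<bar>\<phi> p - c\<bar> \<le> e"
  shows "\<bar>LINT p:Q|M. (a - f p) * \<phi> p\<bar> \<le> d * e * m"
    and "set_integrable M Q (\<lambda>p. (a - f p) * \<phi> p)"
proof -
  have ic: "set_integrable M Q (\<lambda>_. C)" for C :: real
    unfolding set_integrable_def
    by (intro integrable_scaleR_left integrable_real_indicator) (auto simp: m)
  have intQ: "(LINT q:Q|M. C) = C * m" for C
    using m by (simp add: set_lebesgue_integral_def measure_def)
  have af: "set_integrable M Q (\<lambda>p. a - f p)" by (intro set_integral_diff(1) ic f)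
  have zero: "(LINT p:Q|M. a - f p) = 0"
    using m by (subst set_integral_diff(2)[OF ic f]) (simp add: intQ a)
  have "integrable M (\<lambda>p. (indicator Q p *\<^sub>R (a - f p)) * (indicator Q p *\<^sub>R (\<phi> p - c)))"
    by (rule integrable_mult_AE_bounded[where C = "\<bar>e\<bar>"])
       (use af e in \<open>auto simp: set_integrable_def indicator_def intro!: order_trans[OF e]\<close>)
  moreover have "(\<lambda>p. (indicator Q p *\<^sub>R (a - f p)) * (indicator Q p *\<^sub>R (\<phi> p - c))) =
     (\<lambda>p. indicator Q p *\<^sub>R ((a - f p) * (\<phi> p - c)))" by (auto simp: indicator_def)
  ultimately have k: "set_integrable M Q (\<lambda>p. (a - f p) * (\<phi> p - c))"
    unfolding set_integrable_def by simp
  have split: "(a - f p) * \<phi> p = (a - f p) * (\<phi> p - c) + (a - f p) * c" for p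
    by (simp add: algebra_simps)
  have afc: "set_integrable M Q (\<lambda>p. (a - f p) * c)" by (intro set_integrable_mult_left af)
  show "set_integrable M Q (\<lambda>p. (a - f p) * \<phi> p)"
    unfolding split by (intro set_integral_add(1) k afc)
  have "(LINT p:Q|M. (a - f p) * \<phi> p) = (LINT p:Q|M. (a - f p) * (\<phi> p - c)) + (LINT p:Q|M. a - f p) * c"
    unfolding split by (subst set_integral_add(2)[OF k afc]) simp
  also have "\<dots> = (LINT p:Q|M. (a - f p) * (\<phi> p - c))" by (simp add: zero)
  also have "\<bar>\<dots>\<bar> \<le> (LINT p:Q|M. d * e)"
    unfolding set_lebesgue_integral_def
  proof (intro integral_abs_bound[THEN order_trans] integral_mono_AE)
    show "integrable M (\<lambda>p. \<bar>indicator Q p *\<^sub>R ((a - f p) * (\<phi> p - c))\<bar>)"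
      using k unfolding set_integrable_def by (rule integrable_abs)
    show "integrable M (\<lambda>p. indicator Q p *\<^sub>R (d * e))" using ic unfolding set_integrable_def .
    show "AE p in M. \<bar>indicator Q p *\<^sub>R ((a - f p) * (\<phi> p - c))\<bar> \<le> indicator Q p *\<^sub>R (d * e)"
      using d(1)
    proof eventually_elim
      case (elim p)
      show ?case
      proof (cases "p \<in> Q")
        case True
        have "\<bar>a - f p\<bar> * \<bar>\<phi> p - c\<bar> \<le> d * e"
          using elim True e[OF True] d(2) by (intro mult_mono) (auto simp: abs_minus_commute)
        then show ?thesis using True by (simp add: abs_mult)
      qed simp
    qed
  qed
  also have "\<dots> = d * e * m" by (simp add: intQ)
  finally show "\<bar>LINT p:Q|M. (a - f p) * \<phi> p\<bar> \<le> d * e * m" .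
qed

text \<open>
  From \<open>a W - \<rho> \<omega> = W (a - \<rho>) + \<rho> (W - \<omega>)\<close>. The first term keeps the cancellation of
  \<open>covariance_bound\<close>; in the second \<open>W - \<omega>\<close> is uniformly small and \<open>\<rho>\<close> enters through its mass.
\<close>

lemma weighted_deviation_bound:
  fixes \<rho> \<omega> \<phi> :: "'a \<Rightarrow> real"
  assumes [measurable]: "Q \<in> sets M" "\<omega> \<in> borel_measurable M" "\<phi> \<in> borel_measurable M"
    and \<rho>: "set_integrable M Q \<rho>" "AE p in M. 0 \<le> \<rho> p"
    and a: "set_integrable M Q (\<lambda>p. (a - \<rho> p) * \<phi> p)"
    and \<omega>: "AE p in M. p \<in> Q \<longrightarrow> \<bar>\<omega> p - W\<bar> \<le> d" "0 \<le> d" and \<phi>: "\<And>p. \<bar>\<phi> p\<bar> \<le> C"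
  shows "\<bar>LINT p:Q|M. (a * W - \<rho> p * \<omega> p) * \<phi> p\<bar>
    \<le> \<bar>W\<bar> * \<bar>LINT p:Q|M. (a - \<rho> p) * \<phi> p\<bar> + d * C * (LINT p:Q|M. \<rho> p)"
proof -
  have C: "0 \<le> C" using \<phi> abs_ge_zero order_trans by blast
  have factor: "AE p in M. p \<in> Q \<longrightarrow> \<bar>(W - \<omega> p) * \<phi> p\<bar> \<le> d * C"
    using \<omega>(1)
  proof eventually_elim
    case (elim p)
    then show ?case using \<phi>[of p] \<omega>(2) C by (auto simp: abs_mult abs_minus_commute intro!: mult_mono)
  qed
  have "integrable M (\<lambda>p. (indicator Q p *\<^sub>R \<rho> p) * (indicator Q p *\<^sub>R ((W - \<omega> p) * \<phi> p)))"
    by (rule integrable_mult_AE_bounded[where C = "d * C"])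
       (use \<rho> factor \<omega>(2) C in \<open>auto simp: set_integrable_def indicator_def elim!: eventually_mono\<close>)
  moreover have "(\<lambda>p. (indicator Q p *\<^sub>R \<rho> p) * (indicator Q p *\<^sub>R ((W - \<omega> p) * \<phi> p))) =
     (\<lambda>p. indicator Q p *\<^sub>R (\<rho> p * ((W - \<omega> p) * \<phi> p)))" by (auto simp: indicator_def)
  ultimately have k: "set_integrable M Q (\<lambda>p. \<rho> p * ((W - \<omega> p) * \<phi> p))"
    unfolding set_integrable_def by simp
  have Wa: "set_integrable M Q (\<lambda>p. W * ((a - \<rho> p) * \<phi> p))" by (intro set_integrable_mult_right a)
  have split: "(a * W - \<rho> p * \<omega> p) * \<phi> p = W * ((a - \<rho> p) * \<phi> p) + \<rho> p * ((W - \<omega> p) * \<phi> p)" for p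
    by (simp add: algebra_simps)
  have "\<bar>LINT p:Q|M. \<rho> p * ((W - \<omega> p) * \<phi> p)\<bar> \<le> (LINT p:Q|M. d * C * \<rho> p)"
    unfolding set_lebesgue_integral_def
  proof (intro integral_abs_bound[THEN order_trans] integral_mono_AE)
    show "integrable M (\<lambda>p. \<bar>indicator Q p *\<^sub>R (\<rho> p * ((W - \<omega> p) * \<phi> p))\<bar>)"
      using k unfolding set_integrable_def by (rule integrable_abs)
    show "integrable M (\<lambda>p. indicator Q p *\<^sub>R (d * C * \<rho> p))"
      using set_integrable_mult_right[OF \<rho>(1)] unfolding set_integrable_def by blast
    show "AE p in M. \<bar>indicator Q p *\<^sub>R (\<rho> p * ((W - \<omega> p) * \<phi> p))\<bar> \<le> indicator Q p *\<^sub>R (d * C * \<rho> p)"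
      using factor \<rho>(2)
    proof eventually_elim
      case (elim p)
      show ?case
      proof (cases "p \<in> Q")
        case True
        have "\<rho> p * \<bar>(W - \<omega> p) * \<phi> p\<bar> \<le> \<rho> p * (d * C)"
          using elim True by (intro mult_left_mono) auto
        then show ?thesis using True elim(2) by (simp add: abs_mult mult.commute)
      qed simp
    qed
  qed
  also have "\<dots> = d * C * (LINT p:Q|M. \<rho> p)" by (rule set_integral_mult_right)
  finally have 1: "\<bar>LINT p:Q|M. \<rho> p * ((W - \<omega> p) * \<phi> p)\<bar> \<le> d * C * (LINT p:Q|M. \<rho> p)" .
  have "(LINT p:Q|M. (a * W - \<rho> p * \<omega> p) * \<phi> p) =
      W * (LINT p:Q|M. (a - \<rho> p) * \<phi> p) + (LINT p:Q|M. \<rho> p * ((W - \<omega> p) * \<phi> p))"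
    unfolding split by (subst set_integral_add(2)[OF Wa k]) simp
  also have "\<bar>\<dots>\<bar> \<le> \<bar>W * (LINT p:Q|M. (a - \<rho> p) * \<phi> p)\<bar> + \<bar>LINT p:Q|M. \<rho> p * ((W - \<omega> p) * \<phi> p)\<bar>"
    by (rule abs_triangle_ineq)
  also have "\<dots> \<le> \<bar>W\<bar> * \<bar>LINT p:Q|M. (a - \<rho> p) * \<phi> p\<bar> + d * C * (LINT p:Q|M. \<rho> p)"
    using 1 by (simp add: abs_mult)
  finally show ?thesis .
qed

section \<open>The grid\<close>

text \<open>
  The closed cells, as in \<open>cell_average\<close>. They overlap in edges, and the piecewise constant
  functions use half-open cells instead; the difference is a null set.
\<close>

definition cell :: "real \<Rightarrow> nat \<Rightarrow> nat \<Rightarrow> nat \<Rightarrow> (real \<times> real) set" where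
  "cell L N i j = {grid L N i..grid L N (Suc i)} \<times> {grid L N j..grid L N (Suc j)}"

lemma grid_Suc: "grid L N (Suc i) = grid L N i + 2 * L / real N"
  by (simp add: grid_def distrib_right add_divide_distrib)

lemma closed_square_in_sets: "{a..b} \<times> {c..d} \<in> sets (lebesgue :: (real \<times> real) measure)"
  by (intro sets_completionI_sets) (auto intro!: borel_closed closed_Times)

lemma square_complement_in_sets:
  "- ({-L..L} \<times> {-L..L}) \<in> sets (lebesgue :: (real \<times> real) measure)"
  using sets.compl_sets[OF closed_square_in_sets[of "-L" L "-L" L]] by (simp add: Compl_eq_Diff_UNIV)

lemma AE_half_open_rectangle:
  fixes a b c d :: real
  shows
  "AE p in lebesgue. p \<in> {a..<b} \<times> {c..<d} \<longleftrightarrow> p \<in> {a..b} \<times> {c..d}"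
  unfolding AE_completion_iff
proof (rule AE_I')
  show "cbox (a, c) (b, d) - box (a, c) (b, d) \<in> null_sets lborel" by (rule null_sets_cbox_Diff_box)
  show "{p \<in> space lborel. (p \<in> {a..<b} \<times> {c..<d}) \<noteq> (p \<in> {a..b} \<times> {c..d})}
      \<subseteq> cbox (a, c) (b, d) - box (a, c) (b, d)"
    by (auto simp: box_prod)
qed

lemma sum_grid_indicators:
  assumes "0 < L" "1 \<le> N"
  shows "(\<Sum>i<N. indicat_real {grid L N i..<grid L N (Suc i)} x) = indicator {-L..<L} x"
proof -
  have "(\<Sum>i<n. indicat_real {grid L N i..<grid L N (Suc i)} x) = indicator {-L..<grid L N n} x" for n
  proof (induction n)
    case 0
    then show ?case by (simp add: grid_def)
  next
    case (Suc n)
    have "0 \<le> 2 * L / real N" "0 \<le> real n * (2 * L / real N)" using assms by auto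
    then have "-L \<le> grid L N n" "grid L N n \<le> grid L N (Suc n)"
      unfolding grid_Suc by (auto simp: grid_def)
    then show ?case using Suc by (auto simp: indicator_def)
  qed
  moreover have "grid L N N = L" using assms by (simp add: grid_def)
  ultimately show ?thesis by metis
qed

lemma sum_cell_indicators_AE:
  assumes "0 < L" "1 \<le> N"
  shows "AE p in lebesgue. (\<Sum>i<N. \<Sum>j<N. indicat_real (cell L N i j) p) + indicator (- ({-L..L} \<times> {-L..L})) p = 1
    \<and> (\<forall>i<N. \<forall>j<N. indicat_real (cell L N i j) p =
        indicator {grid L N i..<grid L N (Suc i)} (fst p) * indicator {grid L N j..<grid L N (Suc j)} (snd p))"
proof -
  have "AE p in lebesgue. \<forall>i\<in>{..<N}. \<forall>j\<in>{..<N}. indicat_real (cell L N i j) p =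
        indicator {grid L N i..<grid L N (Suc i)} (fst p) * indicator {grid L N j..<grid L N (Suc j)} (snd p)"
    unfolding cell_def
    by (intro AE_finite_allI finite_lessThan, rule eventually_mono[OF AE_half_open_rectangle])
       (auto simp: indicator_def)
  then show ?thesis using AE_half_open_rectangle[of "-L" L "-L" L]
  proof eventually_elim
    case (elim p)
    have "(\<Sum>i<N. \<Sum>j<N. indicat_real (cell L N i j) p) =
      (\<Sum>i<N. \<Sum>j<N. indicator {grid L N i..<grid L N (Suc i)} (fst p) * indicator {grid L N j..<grid L N (Suc j)} (snd p))"
      using elim(1) by (intro sum.cong refl) auto
    also have "\<dots> = (\<Sum>i<N. indicator {grid L N i..<grid L N (Suc i)} (fst p)) *
         (\<Sum>j<N. indicator {grid L N j..<grid L N (Suc j)} (snd p))"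
      by (simp add: sum_product)
    also have "\<dots> = indicator {-L..<L} (fst p) * indicator {-L..<L} (snd p)"
      unfolding sum_grid_indicators[OF assms] ..
    also have "\<dots> = 1 - indicator (- ({-L..L} \<times> {-L..L})) p"
      using elim(2) by (cases p) (auto simp: indicator_def)
    finally show ?case using elim(1) by simp
  qed
qed

lemma cell_in_sets: "cell L N i j \<in> sets lebesgue"
  unfolding cell_def by (rule closed_square_in_sets)

lemma emeasure_cell:
  assumes "0 < L" "1 \<le> N"
  shows "emeasure lebesgue (cell L N i j) = ennreal ((2 * L / real N)\<^sup>2)"
proof -
  have "0 \<le> 2 * L / real N" using assms by simp
  then have "emeasure lborel (cell L N i j) = ennreal ((2 * L / real N)\<^sup>2)"
    unfolding cell_def grid_Suc lborel_prod[symmetric]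
    by (simp add: lborel.emeasure_pair_measure_Times ennreal_mult[symmetric] power2_eq_square)
  moreover have "cell L N i j \<in> sets borel"
    unfolding cell_def by (intro borel_closed closed_Times) auto
  ultimately show ?thesis by simp
qed

lemma integral_double_sum:
  fixes f :: "nat \<Rightarrow> nat \<Rightarrow> 'a \<Rightarrow> real"
  assumes "\<And>i j. integrable M (f i j)"
  shows "(LINT p|M. (\<Sum>i\<in>I. \<Sum>j\<in>J. f i j p)) = (\<Sum>i\<in>I. \<Sum>j\<in>J. LINT p|M. f i j p)"
proof -
  have "(LINT p|M. (\<Sum>i\<in>I. \<Sum>j\<in>J. f i j p)) = (\<Sum>i\<in>I. LINT p|M. (\<Sum>j\<in>J. f i j p))"
    by (intro Bochner_Integration.integral_sum Bochner_Integration.integrable_sum assms)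
  also have "\<dots> = (\<Sum>i\<in>I. \<Sum>j\<in>J. LINT p|M. f i j p)"
    by (intro sum.cong refl Bochner_Integration.integral_sum assms)
  finally show ?thesis .
qed

lemma integral_split_cells:
  fixes F :: "real \<times> real \<Rightarrow> real"
  assumes "0 < L" "1 \<le> N" and F: "integrable lebesgue F"
  shows "(LINT p|lebesgue. F p) = (\<Sum>i<N. \<Sum>j<N. LINT p:cell L N i j|lebesgue. F p)
     + (LINT p:- ({-L..L} \<times> {-L..L})|lebesgue. F p)"
proof -
  note S = square_complement_in_sets[of L]
  have ic: "integrable lebesgue (\<lambda>p. indicator A p *\<^sub>R F p)" if "A \<in> sets lebesgue" for A
    by (rule integrable_mult_indicator[OF that F])
  have "(LINT p|lebesgue. F p) = (LINT p|lebesgue. (\<Sum>i<N. \<Sum>j<N. indicator (cell L N i j) p *\<^sub>R F p)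
     + indicator (- ({-L..L} \<times> {-L..L})) p *\<^sub>R F p)"
  proof (rule integral_cong_AE)
    show "F \<in> borel_measurable lebesgue" using F by simp
    then show "(\<lambda>p. (\<Sum>i<N. \<Sum>j<N. indicator (cell L N i j) p *\<^sub>R F p)
     + indicator (- ({-L..L} \<times> {-L..L})) p *\<^sub>R F p) \<in> borel_measurable lebesgue"
      using S cell_in_sets by (intro borel_measurable_add borel_measurable_sum borel_measurable_scaleR borel_measurable_indicator) auto
    show "AE p in lebesgue. F p = (\<Sum>i<N. \<Sum>j<N. indicator (cell L N i j) p *\<^sub>R F p)
     + indicator (- ({-L..L} \<times> {-L..L})) p *\<^sub>R F p"
      using sum_cell_indicators_AE[OF assms(1,2)]
    proof eventually_elim
      case (elim p)
      have "F p = ((\<Sum>i<N. \<Sum>j<N. indicat_real (cell L N i j) p) + indicator (- ({-L..L} \<times> {-L..L})) p) * F p"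
        by (simp only: conjunct1[OF elim] mult_1)
      then show ?case by (simp only: distrib_right sum_distrib_right real_scaleR_def)
    qed
  qed
  also have "\<dots> = (\<Sum>i<N. \<Sum>j<N. LINT p:cell L N i j|lebesgue. F p)
     + (LINT p:- ({-L..L} \<times> {-L..L})|lebesgue. F p)"
    unfolding set_lebesgue_integral_def
    by (subst Bochner_Integration.integral_add[OF _ ic[OF S]])
       (intro Bochner_Integration.integrable_sum ic cell_in_sets, simp only: integral_double_sum[OF ic[OF cell_in_sets]])
  finally show ?thesis .
qed

section \<open>The error of the piecewise constant approximation\<close>

lemma abs_set_integral_mult_le:
  fixes \<rho> w :: "'a \<Rightarrow> real"
  assumes [measurable]: "A \<in> sets M" "w \<in> borel_measurable M"
    and \<rho>: "set_integrable M A \<rho>" "AE p in M. 0 \<le> \<rho> p" and w: "AE p in M. \<bar>w p\<bar> \<le> C"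
  shows "\<bar>LINT p:A|M. \<rho> p * w p\<bar> \<le> C * (LINT p:A|M. \<rho> p)"
proof -
  have "\<bar>LINT p:A|M. \<rho> p * w p\<bar> \<le> (LINT p:A|M. C * \<rho> p)"
    unfolding set_lebesgue_integral_def
  proof (intro integral_abs_bound[THEN order_trans] integral_mono_AE)
    have "integrable M (\<lambda>p. (indicator A p *\<^sub>R \<rho> p) * w p)"
      by (rule integrable_mult_AE_bounded[OF _ _ w]) (use \<rho>(1) in \<open>simp_all add: set_integrable_def\<close>)
    then show "integrable M (\<lambda>p. \<bar>indicator A p *\<^sub>R (\<rho> p * w p)\<bar>)"
      by (intro integrable_abs) (simp add: mult.assoc)
    show "integrable M (\<lambda>p. indicator A p *\<^sub>R (C * \<rho> p))"
      using set_integrable_mult_right[OF \<rho>(1)] unfolding set_integrable_def by blast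
    show "AE p in M. \<bar>indicator A p *\<^sub>R (\<rho> p * w p)\<bar> \<le> indicator A p *\<^sub>R (C * \<rho> p)"
      using \<rho>(2) w
    proof eventually_elim
      case (elim p)
      have "\<rho> p * \<bar>w p\<bar> \<le> \<rho> p * C" using elim by (intro mult_left_mono)
      then show ?case using elim(1) by (simp add: abs_mult mult.commute indicator_def)
    qed
  qed
  also have "\<dots> = C * (LINT p:A|M. \<rho> p)" by (rule set_integral_mult_right)
  finally show ?thesis .
qed

lemma set_integrable_const_cell:
  fixes C :: real
  assumes "0 < L" "1 \<le> N"
  shows "set_integrable lebesgue (cell L N i j) (\<lambda>_. C)"
    and "(LINT p:cell L N i j|lebesgue. C) = C * (2 * L / real N)\<^sup>2"
proof -
  show "set_integrable lebesgue (cell L N i j) (\<lambda>_. C)"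
    unfolding set_integrable_def
    by (intro integrable_scaleR_left integrable_real_indicator cell_in_sets)
       (simp add: emeasure_cell[OF assms])
  show "(LINT p:cell L N i j|lebesgue. C) = C * (2 * L / real N)\<^sup>2"
    using emeasure_cell[OF assms] cell_in_sets by (simp add: set_lebesgue_integral_def measure_def)
qed

text \<open>
  The cells partition the square up to a null set, and the step function vanishes outside it, so
  the error is the sum of the cell errors and the integral of \<open>F \<phi>\<close> outside the square. It is used
  with \<open>F = \<rho>\<close> and with \<open>F = \<rho> \<omega>\<close>.
\<close>

lemma step_function_error:
  fixes F \<phi> :: "real \<times> real \<Rightarrow> real" and c :: "nat \<Rightarrow> nat \<Rightarrow> real"
  assumes LN: "0 < L" "1 \<le> N" and F: "integrable lebesgue F"
    and \<phi>: "\<phi> \<in> borel_measurable lebesgue" "\<And>p. \<bar>\<phi> p\<bar> \<le> C"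
  defines "s \<equiv> \<lambda>(x, y). \<Sum>i<N. \<Sum>j<N. c i j *
     indicat_real {grid L N i..<grid L N (Suc i)} x *
     indicat_real {grid L N j..<grid L N (Suc j)} y"
  shows "\<bar>(LINT p|lebesgue. s p * \<phi> p) - (LINT p|lebesgue. F p * \<phi> p)\<bar>
    \<le> (\<Sum>i<N. \<Sum>j<N. \<bar>LINT p:cell L N i j|lebesgue. (c i j - F p) * \<phi> p\<bar>)
      + \<bar>LINT p:- ({-L..L} \<times> {-L..L})|lebesgue. F p * \<phi> p\<bar>"
proof -
  let ?I = "\<lambda>i j f. LINT p:cell L N i j|lebesgue. f p"
  have F\<phi>: "integrable lebesgue (\<lambda>p. F p * \<phi> p)"
    by (rule integrable_mult_AE_bounded[OF F \<phi>(1), of C]) (intro AE_I2 \<phi>(2))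
  have c\<phi>: "set_integrable lebesgue (cell L N i j) (\<lambda>p. d * \<phi> p)" for i j d
  proof -
    have "integrable lebesgue (\<lambda>p. (indicator (cell L N i j) p *\<^sub>R d) * \<phi> p)"
      using set_integrable_const_cell(1)[OF LN] unfolding set_integrable_def
      by (rule integrable_mult_AE_bounded[OF _ \<phi>(1), of _ C]) (intro AE_I2 \<phi>(2))
    then show ?thesis by (simp add: set_integrable_def mult.assoc)
  qed
  have "(LINT p|lebesgue. s p * \<phi> p) =
      (LINT p|lebesgue. (\<Sum>i<N. \<Sum>j<N. indicator (cell L N i j) p *\<^sub>R (c i j * \<phi> p)))"
  proof (rule integral_cong_AE)
    show m: "(\<lambda>p. \<Sum>i<N. \<Sum>j<N. indicator (cell L N i j) p *\<^sub>R (c i j * \<phi> p)) \<in> borel_measurable lebesgue"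
      using c\<phi> unfolding set_integrable_def by (intro borel_measurable_sum borel_measurable_integrable)
    have "s \<in> borel_measurable borel"
      unfolding s_def case_prod_beta' by measurable
    then have "s \<in> borel_measurable lebesgue" by (auto intro: measurable_completion)
    then show "(\<lambda>p. s p * \<phi> p) \<in> borel_measurable lebesgue" using \<phi>(1) by (rule borel_measurable_times)
    show "AE p in lebesgue. s p * \<phi> p = (\<Sum>i<N. \<Sum>j<N. indicator (cell L N i j) p *\<^sub>R (c i j * \<phi> p))"
      using sum_cell_indicators_AE[OF LN]
    proof eventually_elim
      case (elim p)
      have "s p * \<phi> p = (\<Sum>i<N. \<Sum>j<N. c i j *
         indicat_real {grid L N i..<grid L N (Suc i)} (fst p) *
         indicat_real {grid L N j..<grid L N (Suc j)} (snd p) * \<phi> p)"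
        unfolding s_def case_prod_beta' by (simp only: sum_distrib_right)
      also have "\<dots> = (\<Sum>i<N. \<Sum>j<N. indicator (cell L N i j) p *\<^sub>R (c i j * \<phi> p))"
        using elim by (intro sum.cong refl) (simp add: mult_ac)
      finally show ?case .
    qed
  qed
  also have "\<dots> = (\<Sum>i<N. \<Sum>j<N. ?I i j (\<lambda>p. c i j * \<phi> p))"
    using c\<phi> unfolding set_integrable_def set_lebesgue_integral_def
    by (intro integral_double_sum)
  finally have "(LINT p|lebesgue. s p * \<phi> p) - (LINT p|lebesgue. F p * \<phi> p) =
      (\<Sum>i<N. \<Sum>j<N. ?I i j (\<lambda>p. c i j * \<phi> p) - ?I i j (\<lambda>p. F p * \<phi> p)) -
      (LINT p:- ({-L..L} \<times> {-L..L})|lebesgue. F p * \<phi> p)"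
    unfolding integral_split_cells[OF LN F\<phi>] by (simp add: sum_subtractf)
  also have "(\<Sum>i<N. \<Sum>j<N. ?I i j (\<lambda>p. c i j * \<phi> p) - ?I i j (\<lambda>p. F p * \<phi> p)) =
      (\<Sum>i<N. \<Sum>j<N. ?I i j (\<lambda>p. (c i j - F p) * \<phi> p))"
  proof (intro sum.cong refl)
    fix i j
    have "set_integrable lebesgue (cell L N i j) (\<lambda>p. F p * \<phi> p)"
      unfolding set_integrable_def by (rule integrable_mult_indicator[OF cell_in_sets F\<phi>])
    from set_integral_diff(2)[OF c\<phi> this, of "c i j"]
    show "?I i j (\<lambda>p. c i j * \<phi> p) - ?I i j (\<lambda>p. F p * \<phi> p) = ?I i j (\<lambda>p. (c i j - F p) * \<phi> p)"
      by (simp only: left_diff_distrib)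
  qed
  also have "\<bar>\<dots> - (LINT p:- ({-L..L} \<times> {-L..L})|lebesgue. F p * \<phi> p)\<bar> \<le>
      \<bar>\<Sum>i<N. \<Sum>j<N. ?I i j (\<lambda>p. (c i j - F p) * \<phi> p)\<bar> +
      \<bar>LINT p:- ({-L..L} \<times> {-L..L})|lebesgue. F p * \<phi> p\<bar>"
    by (rule abs_triangle_ineq4)
  also have "\<bar>\<Sum>i<N. \<Sum>j<N. ?I i j (\<lambda>p. (c i j - F p) * \<phi> p)\<bar> \<le>
      (\<Sum>i<N. \<Sum>j<N. \<bar>?I i j (\<lambda>p. (c i j - F p) * \<phi> p)\<bar>)"
    by (rule order_trans[OF sum_abs]) (intro sum_mono sum_abs)
  finally show ?thesis by simp
qed

lemma cell_average_eq:
  "cell_average f L N i j = (LINT p:cell L N i j|lebesgue. f p) / (2 * L / real N)\<^sup>2"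
  by (simp add: cell_average_def cell_def power_divide power_mult_distrib)

lemma cell_average_AE_deviation:
  assumes LN: "0 < L" "1 \<le> N" and fm: "f \<in> borel_measurable lebesgue"
    and wx: "has_weak_partial_x f fx" "fx \<in> Linf" and wy: "has_weak_partial_y f fy" "fy \<in> Linf"
  shows "AE p in lebesgue. p \<in> cell L N i j \<longrightarrow>
    \<bar>f p - cell_average f L N i j\<bar> \<le> 2 * L / real N * (Linf_norm fx + Linf_norm fy)"
  unfolding cell_average_eq cell_def grid_Suc
  by (rule cell_average_deviation[OF fm wx wy]) (use LN in simp)

text \<open>
  Both \<open>\<rho>\<close> and \<open>\<phi>\<close> vary on the cell by \<open>h = 2 L / N\<close> times their gradient bounds and the cell has
  area \<open>h\<^sup>2\<close>; the constant \<open>16 L ^ 4\<close> is \<open>(h N) ^ 4\<close>.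
\<close>

lemma cell_error:
  fixes i j :: nat
  assumes LN: "0 < L" "1 \<le> N" and \<rho>: "integrable lebesgue \<rho>"
    and wx: "has_weak_partial_x \<rho> \<rho>x" "\<rho>x \<in> Linf" and wy: "has_weak_partial_y \<rho> \<rho>y" "\<rho>y \<in> Linf"
    and \<phi>: "\<phi> \<in> Cc_infinity"
  defines "a \<equiv> cell_average \<rho> L N i j"
  shows "\<bar>LINT p:cell L N i j|lebesgue. (a - \<rho> p) * \<phi> p\<bar> \<le> C_const L \<rho>x \<rho>y \<phi> / real N ^ 4"
    and "set_integrable lebesgue (cell L N i j) (\<lambda>p. (a - \<rho> p) * \<phi> p)"
proof -
  let ?h = "2 * L / real N"
  have h: "0 < ?h" using LN by simp
  have AB: "0 \<le> Linf_norm \<rho>x + Linf_norm \<rho>y" using Linf_norm_AE_bound(2) wx(2) wy(2) by simp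
  have \<rho>c: "set_integrable lebesgue (cell L N i j) \<rho>"
    unfolding set_integrable_def by (rule integrable_mult_indicator[OF cell_in_sets \<rho>])
  note \<phi>m = Cc_infinity_measurable[OF \<phi>]
  have dev: "\<bar>\<phi> p - \<phi> (grid L N i, grid L N j)\<bar> \<le> ?h * (Linf_norm (partial_x \<phi>) + Linf_norm (partial_y \<phi>))"
    if p: "p \<in> cell L N i j" for p
  proof -
    let ?q = "(grid L N i, grid L N j)"
    have "\<bar>fst p - fst ?q\<bar> \<le> ?h" "\<bar>snd p - snd ?q\<bar> \<le> ?h"
      using p unfolding cell_def grid_Suc by auto
    then have "Linf_norm (partial_x \<phi>) * \<bar>fst p - fst ?q\<bar> + Linf_norm (partial_y \<phi>) * \<bar>snd p - snd ?q\<bar>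
        \<le> Linf_norm (partial_x \<phi>) * ?h + Linf_norm (partial_y \<phi>) * ?h"
      using Cc_infinity_bounds(5,6)[OF \<phi>] by (intro add_mono mult_left_mono)
    also have "\<dots> = ?h * (Linf_norm (partial_x \<phi>) + Linf_norm (partial_y \<phi>))"
      by (simp only: distrib_left mult.commute[of ?h])
    finally show ?thesis by (rule order_trans[OF Cc_infinity_Lipschitz[OF \<phi>]])
  qed
  have regroup: "x * A * (x * B) * x\<^sup>2 = x ^ 4 * A * B" for x A B :: real
    by (simp add: power2_eq_square power4_eq_xxxx mult_ac)
  have h4: "?h ^ 4 = 16 * L ^ 4 / real N ^ 4" by (simp add: power_divide power_mult_distrib)
  have h2: "0 < ?h\<^sup>2" using LN by simp
  have d0: "0 \<le> ?h * (Linf_norm \<rho>x + Linf_norm \<rho>y)" using h AB by (intro mult_nonneg_nonneg) simp_all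
  have a: "a = (LINT p:cell L N i j|lebesgue. \<rho> p) / ?h\<^sup>2" unfolding a_def by (rule cell_average_eq)
  have \<rho>m: "\<rho> \<in> borel_measurable lebesgue" using \<rho> by simp
  note cov = covariance_bound[OF cell_in_sets emeasure_cell[OF LN] h2 \<rho>c a \<phi>m
      cell_average_AE_deviation[OF LN \<rho>m wx wy, of i j, folded a_def] d0 dev]
  show "set_integrable lebesgue (cell L N i j) (\<lambda>p. (a - \<rho> p) * \<phi> p)" by (rule cov(2))
  have "\<bar>LINT p:cell L N i j|lebesgue. (a - \<rho> p) * \<phi> p\<bar> \<le>
     ?h * (Linf_norm \<rho>x + Linf_norm \<rho>y) * (?h * (Linf_norm (partial_x \<phi>) + Linf_norm (partial_y \<phi>))) * ?h\<^sup>2"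
    by (rule cov(1))
  also have "\<dots> = ?h ^ 4 * (Linf_norm \<rho>x + Linf_norm \<rho>y) * (Linf_norm (partial_x \<phi>) + Linf_norm (partial_y \<phi>))"
    by (rule regroup)
  also have "\<dots> = C_const L \<rho>x \<rho>y \<phi> / real N ^ 4"
    unfolding C_const_def h4 by (simp only: times_divide_eq_left)
  finally show "\<bar>LINT p:cell L N i j|lebesgue. (a - \<rho> p) * \<phi> p\<bar> \<le> C_const L \<rho>x \<rho>y \<phi> / real N ^ 4" .
qed

lemma abs_cell_average_le:
  assumes LN: "0 < L" "1 \<le> N" and \<omega>: "\<omega> \<in> Linf"
  shows "\<bar>cell_average \<omega> L N i j\<bar> \<le> Linf_norm \<omega>"
proof -
  let ?h = "2 * L / real N"
  have h: "0 < ?h\<^sup>2" using LN by simp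
  have "\<bar>LINT p:cell L N i j|lebesgue. 1 * \<omega> p\<bar> \<le> Linf_norm \<omega> * (LINT p:cell L N i j|lebesgue. 1)"
    using \<omega> by (intro abs_set_integral_mult_le cell_in_sets set_integrable_const_cell[OF LN] Linf_norm_AE_bound)
       (auto simp: Linf_def)
  also have "(LINT p:cell L N i j|lebesgue. 1) = ?h\<^sup>2" by (subst set_integrable_const_cell(2)[OF LN]) simp
  finally have "\<bar>LINT p:cell L N i j|lebesgue. \<omega> p\<bar> \<le> Linf_norm \<omega> * ?h\<^sup>2" by simp
  then have "\<bar>LINT p:cell L N i j|lebesgue. \<omega> p\<bar> / ?h\<^sup>2 \<le> Linf_norm \<omega>"
    unfolding pos_divide_le_eq[OF h] .
  then show ?thesis unfolding cell_average_eq abs_divide by simp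
qed

lemma sum_cells_const: "(\<Sum>i<N. \<Sum>j<N. C / real N ^ 4) = C / (real N)\<^sup>2" if "1 \<le> N"
  using that by (simp add: power2_eq_square power4_eq_xxxx)

theorem theorem1p2:
  fixes \<rho> \<rho>x \<rho>y :: "real \<times> real \<Rightarrow> real" and \<epsilon> L :: real
  assumes "integrable lebesgue \<rho>"
    and "AE p in lebesgue. 0 \<le> \<rho> p"
    and "has_weak_partial_x \<rho> \<rho>x" and "\<rho>x \<in> Linf"
    and "has_weak_partial_y \<rho> \<rho>y" and "\<rho>y \<in> Linf"
    and "0 < \<epsilon>" and "0 < L"
    and "(LINT p:- ({-L..L} \<times> {-L..L})|lebesgue. \<rho> p) \<le> \<epsilon>"
  shows "(\<forall>\<phi>\<in>Cc_infinity. \<forall>N::nat. 1 \<le> N \<longrightarrow>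
            \<bar>(LINT p|lebesgue. rho_hat \<rho> L N p * \<phi> p) - (LINT p|lebesgue. \<rho> p * \<phi> p)\<bar>
              \<le> \<epsilon> * Linf_norm \<phi> + C_const L \<rho>x \<rho>y \<phi> / (real N)\<^sup>2) \<and>
         (\<forall>\<omega> \<omega>x \<omega>y :: real \<times> real \<Rightarrow> real.
            \<omega> \<in> Linf \<and> has_weak_partial_x \<omega> \<omega>x \<and> \<omega>x \<in> Linf \<and>
            has_weak_partial_y \<omega> \<omega>y \<and> \<omega>y \<in> Linf \<longrightarrow>
            (\<forall>\<phi>\<in>Cc_infinity. \<forall>N::nat. 1 \<le> N \<longrightarrow>
              \<bar>(LINT p|lebesgue. rho_omega_hat \<rho> \<omega> L N p * \<phi> p)
                 - (LINT p|lebesgue. \<rho> p * \<omega> p * \<phi> p)\<bar>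
                \<le> \<epsilon> * Linf_norm \<phi> * Linf_norm \<omega>
                   + C_const L \<rho>x \<rho>y \<phi> * Linf_norm \<omega> / (real N)\<^sup>2
                   + K_const L \<omega>x \<omega>y \<rho> \<phi> / real N))"
proof (intro conjI ballI allI impI)
  let ?S = "- ({-L..L} \<times> {-L..L})"
  note \<rho> = assms(1,2) and L = assms(8) and tail = assms(9)
  note S = square_complement_in_sets[of L]
  note \<phi>m = Cc_infinity_measurable
  have \<rho>S: "set_integrable lebesgue A \<rho>" if "A \<in> sets lebesgue" for A
    unfolding set_integrable_def by (rule integrable_mult_indicator[OF that \<rho>(1)])
  note cell_error = cell_error[OF L _ \<rho>(1) assms(3-6)]
  {
    fix \<phi> and N :: nat assume \<phi>: "\<phi> \<in> Cc_infinity" and N: "1 \<le> N"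
    have "\<bar>(LINT p|lebesgue. rho_hat \<rho> L N p * \<phi> p) - (LINT p|lebesgue. \<rho> p * \<phi> p)\<bar>
      \<le> (\<Sum>i<N. \<Sum>j<N. \<bar>LINT p:cell L N i j|lebesgue. (cell_average \<rho> L N i j - \<rho> p) * \<phi> p\<bar>)
        + \<bar>LINT p:?S|lebesgue. \<rho> p * \<phi> p\<bar>"
      unfolding rho_hat_def by (rule step_function_error[OF L N \<rho>(1) \<phi>m[OF \<phi>] Cc_infinity_bounds(1)[OF \<phi>]])
    also have "\<dots> \<le> (\<Sum>i<N. \<Sum>j<N. C_const L \<rho>x \<rho>y \<phi> / real N ^ 4) + Linf_norm \<phi> * (LINT p:?S|lebesgue. \<rho> p)"
      by (intro add_mono sum_mono cell_error(1)[OF N \<phi>] abs_set_integral_mult_le S \<phi>m[OF \<phi>] \<rho>S \<rho>(2))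
         (simp add: Cc_infinity_bounds(1)[OF \<phi>])
    also have "\<dots> \<le> C_const L \<rho>x \<rho>y \<phi> / (real N)\<^sup>2 + Linf_norm \<phi> * \<epsilon>"
      unfolding sum_cells_const[OF N]
      by (intro add_left_mono mult_left_mono tail Cc_infinity_bounds(4)[OF \<phi>])
    finally show "\<bar>(LINT p|lebesgue. rho_hat \<rho> L N p * \<phi> p) - (LINT p|lebesgue. \<rho> p * \<phi> p)\<bar>
              \<le> \<epsilon> * Linf_norm \<phi> + C_const L \<rho>x \<rho>y \<phi> / (real N)\<^sup>2"
      by (simp add: mult.commute add.commute)
  next
    fix \<omega> \<omega>x \<omega>y \<phi> and N :: nat
    assume "\<omega> \<in> Linf \<and> has_weak_partial_x \<omega> \<omega>x \<and> \<omega>x \<in> Linf \<and> has_weak_partial_y \<omega> \<omega>y \<and> \<omega>y \<in> Linf"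
      and \<phi>: "\<phi> \<in> Cc_infinity" and N: "1 \<le> N"
    then have \<omega>: "\<omega> \<in> Linf" and wx: "has_weak_partial_x \<omega> \<omega>x" "\<omega>x \<in> Linf"
      and wy: "has_weak_partial_y \<omega> \<omega>y" "\<omega>y \<in> Linf" by auto
    have \<omega>m: "\<omega> \<in> borel_measurable lebesgue" using \<omega> by (simp add: Linf_def)
    note \<omega>b = Linf_norm_AE_bound[OF \<omega>]
    have \<rho>\<omega>: "integrable lebesgue (\<lambda>p. \<rho> p * \<omega> p)"
      by (rule integrable_mult_AE_bounded[OF \<rho>(1) \<omega>m \<omega>b(1)])
    let ?M = "Linf_norm \<omega>" and ?\<Phi> = "Linf_norm \<phi>"
    let ?d = "2 * L / real N * (Linf_norm \<omega>x + Linf_norm \<omega>y)"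
    have d: "0 \<le> ?d" using L Linf_norm_AE_bound(2)[OF wx(2)] Linf_norm_AE_bound(2)[OF wy(2)] by simp
    have per_cell: "\<bar>LINT p:cell L N i j|lebesgue.
        (cell_average \<rho> L N i j * cell_average \<omega> L N i j - \<rho> p * \<omega> p) * \<phi> p\<bar>
      \<le> ?M * (C_const L \<rho>x \<rho>y \<phi> / real N ^ 4) + ?d * ?\<Phi> * (LINT p:cell L N i j|lebesgue. \<rho> p)" for i j
    proof -
      have "\<bar>LINT p:cell L N i j|lebesgue.
          (cell_average \<rho> L N i j * cell_average \<omega> L N i j - \<rho> p * \<omega> p) * \<phi> p\<bar>
        \<le> \<bar>cell_average \<omega> L N i j\<bar> * \<bar>LINT p:cell L N i j|lebesgue. (cell_average \<rho> L N i j - \<rho> p) * \<phi> p\<bar>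
          + ?d * ?\<Phi> * (LINT p:cell L N i j|lebesgue. \<rho> p)"
        by (rule weighted_deviation_bound[OF cell_in_sets \<omega>m \<phi>m[OF \<phi>] \<rho>S[OF cell_in_sets] \<rho>(2)
             cell_error(2)[OF N \<phi>] cell_average_AE_deviation[OF L N \<omega>m wx wy] d Cc_infinity_bounds(1)[OF \<phi>]])
      also have "\<dots> \<le> ?M * (C_const L \<rho>x \<rho>y \<phi> / real N ^ 4) + ?d * ?\<Phi> * (LINT p:cell L N i j|lebesgue. \<rho> p)"
        by (intro add_right_mono mult_mono abs_cell_average_le[OF L N \<omega>] cell_error(1)[OF N \<phi>] \<omega>b(2)) simp
      finally show ?thesis .
    qed
    have mass: "(\<Sum>i<N. \<Sum>j<N. LINT p:cell L N i j|lebesgue. \<rho> p) \<le> L1_norm \<rho>"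
    proof -
      have "0 \<le> (LINT p:?S|lebesgue. \<rho> p)"
        unfolding set_lebesgue_integral_def using \<rho>(2)
        by (intro integral_nonneg_AE) (auto elim!: eventually_mono)
      moreover have "(LINT p|lebesgue. \<rho> p) \<le> L1_norm \<rho>"
        unfolding L1_norm_def using \<rho>(1) by (intro integral_mono) auto
      ultimately show ?thesis using integral_split_cells[OF L N \<rho>(1)] by linarith
    qed
    have "\<bar>(LINT p|lebesgue. rho_omega_hat \<rho> \<omega> L N p * \<phi> p) - (LINT p|lebesgue. \<rho> p * \<omega> p * \<phi> p)\<bar>
      \<le> (\<Sum>i<N. \<Sum>j<N. \<bar>LINT p:cell L N i j|lebesgue.
            (cell_average \<rho> L N i j * cell_average \<omega> L N i j - \<rho> p * \<omega> p) * \<phi> p\<bar>)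
        + \<bar>LINT p:?S|lebesgue. \<rho> p * \<omega> p * \<phi> p\<bar>"
      unfolding rho_omega_hat_def
      by (rule step_function_error[OF L N \<rho>\<omega> \<phi>m[OF \<phi>] Cc_infinity_bounds(1)[OF \<phi>]])
    also have "\<dots> \<le> (\<Sum>i<N. \<Sum>j<N. ?M * (C_const L \<rho>x \<rho>y \<phi> / real N ^ 4) +
          ?d * ?\<Phi> * (LINT p:cell L N i j|lebesgue. \<rho> p)) + ?\<Phi> * ?M * (LINT p:?S|lebesgue. \<rho> p)"
    proof (intro add_mono sum_mono per_cell)
      have "AE p in lebesgue. \<bar>\<omega> p * \<phi> p\<bar> \<le> ?\<Phi> * ?M"
        using \<omega>b(1)
      proof eventually_elim
        case (elim p)
        have "\<bar>\<phi> p\<bar> * \<bar>\<omega> p\<bar> \<le> ?\<Phi> * ?M"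
          using elim Cc_infinity_bounds(1,4)[OF \<phi>] by (intro mult_mono) auto
        then show ?case by (simp add: abs_mult mult.commute)
      qed
      then have "\<bar>LINT p:?S|lebesgue. \<rho> p * (\<omega> p * \<phi> p)\<bar> \<le> ?\<Phi> * ?M * (LINT p:?S|lebesgue. \<rho> p)"
        by (intro abs_set_integral_mult_le S \<rho>S \<rho>(2) borel_measurable_times \<omega>m \<phi>m[OF \<phi>])
      then show "\<bar>LINT p:?S|lebesgue. \<rho> p * \<omega> p * \<phi> p\<bar> \<le> ?\<Phi> * ?M * (LINT p:?S|lebesgue. \<rho> p)"
        by (simp only: mult.assoc)
    qed
    also have "(\<Sum>i<N. \<Sum>j<N. ?M * (C_const L \<rho>x \<rho>y \<phi> / real N ^ 4) +
          ?d * ?\<Phi> * (LINT p:cell L N i j|lebesgue. \<rho> p)) =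
        ?M * (C_const L \<rho>x \<rho>y \<phi> / (real N)\<^sup>2) +
          ?d * ?\<Phi> * (\<Sum>i<N. \<Sum>j<N. LINT p:cell L N i j|lebesgue. \<rho> p)"
      unfolding sum_cells_const[OF N, symmetric] by (simp only: sum.distrib sum_distrib_left)
    also have "?M * (C_const L \<rho>x \<rho>y \<phi> / (real N)\<^sup>2) +
          ?d * ?\<Phi> * (\<Sum>i<N. \<Sum>j<N. LINT p:cell L N i j|lebesgue. \<rho> p) + ?\<Phi> * ?M * (LINT p:?S|lebesgue. \<rho> p)
        \<le> ?M * (C_const L \<rho>x \<rho>y \<phi> / (real N)\<^sup>2) + ?d * ?\<Phi> * L1_norm \<rho> + ?\<Phi> * ?M * \<epsilon>"
      by (intro add_mono order_refl mult_left_mono mass tail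
          mult_nonneg_nonneg[OF d Cc_infinity_bounds(4)[OF \<phi>]]
          mult_nonneg_nonneg[OF Cc_infinity_bounds(4)[OF \<phi>] \<omega>b(2)])
    also have "?d * ?\<Phi> * L1_norm \<rho> = K_const L \<omega>x \<omega>y \<rho> \<phi> / real N"
      by (simp add: K_const_def)
    finally show "\<bar>(LINT p|lebesgue. rho_omega_hat \<rho> \<omega> L N p * \<phi> p)
                 - (LINT p|lebesgue. \<rho> p * \<omega> p * \<phi> p)\<bar>
                \<le> \<epsilon> * Linf_norm \<phi> * Linf_norm \<omega>
                   + C_const L \<rho>x \<rho>y \<phi> * Linf_norm \<omega> / (real N)\<^sup>2
                   + K_const L \<omega>x \<omega>y \<rho> \<phi> / real N"
      by (simp add: mult_ac add_ac)
  }
qed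

end
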